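(* Let $Q\subseteq\mathbb{R}^{n}$ be a compact semialgebraic set (with the metric induced from $\mathbb{R}^n$), and consider the system of linear equations $$A(x)\phi(x)=\gamma(x),\qquad x\in Q,$$ where $A(x)=(a_{ij}(x))\in M_{r,s}(\mathbb{R})$ is a real $r\times s$ matrix and $\gamma(x)=(\gamma_i(x))\in\mathbb{R}^{r}$, and all the entries $a_{ij}$ and $\gamma_i$ are semialgebraic (not necessarily continuous) functions on $\mathbb{R}^{n}$. Let $\mathcal{H}=(H_x)_{x\in Q}$ be the bundle with fibers $H_x=\{\lambda\in\mathbb{R}^{s}: A(x)\lambda=\gamma(x)\}$, and let $\mathcal{H}^{\mathrm{Gl}}=(H_x^{\mathrm{Gl}})_{x\in Q}$ be its Glaeser-stable refinement. Then there exists a continuous semialgebraic function $\phi:Q\to\mathbb{R}^{s}$ satisfying $A(x)\phi(x)=\gamma(x)$ for all $x\in Q$ if and only if $\mathcal{H}^{\mathrm{Gl}}$ has no empty fiber, i.e. $H_x^{\mathrm{Gl}}\neq\emptyset$ for every $x\in Q$.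
   Context: A function between subsets of Euclidean spaces is semialgebraic if its graph is a semialgebraic set. All spaces $\mathbb{R}^s$ carry the Euclidean norm. A (singular affine) bundle over $Q$ is a family $\mathcal{H}=(H_x)_{x\in Q}$ of affine subspaces $H_x\subseteq\mathbb{R}^{s}$ parametrized by the points of $Q$; the empty set and the whole space $\mathbb{R}^s$ are allowed as affine subspaces. The $H_x$ are called the fibers. The Glaeser refinements of $\mathcal{H}$ are defined by $\mathcal{H}^{(0)}:=\mathcal{H}$ and, for $k\ge 1$, $\mathcal{H}^{(k)}=(H^{(k)}_x)_{x\in Q}$ with $$H_{x}^{(k)}:=\{\lambda\in H_{x}^{(k-1)}:\ \mathrm{dist}(\lambda,H_{y}^{(k-1)})\to 0\ \text{as } y\to x,\ y\in Q\}\qquad (x\in Q),$$ where $\mathrm{dist}$ is Euclidean distance and $\mathrm{dist}(\lambda,\emptyset)=+\infty$. Each $\mathcal{H}^{(k)}$ is again a bundle and a subbundle of $\mathcal{H}^{(k-1)}$. It is a known fact (Fefferman) that this procedure stabilizes: there is $k_0\in\mathbb{N}$ such that $\mathcal{H}^{(k)}=\mathcal{H}^{(k_0)}$ for all $k\ge k_0$. The Glaeser-stable refinement is $\mathcal{H}^{\mathrm{Gl}}:=\mathcal{H}^{(k_0)}$, with fibers $H_x^{\mathrm{Gl}}$. *)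

theory Defs
  imports "HOL-Analysis.Analysis"
begin

text \<open>
  The semialgebraic sets form the smallest Boolean algebra of subsets containing all sets
  \<open>{x. p x > 0}\<close> with \<open>p\<close> polynomial; note that \<open>p x = 0\<close> iff neither \<open>p x > 0\<close> nor
  \<open>- p x > 0\<close>.  On a Euclidean space \<^const>\<open>real_polynomial_function\<close> describes exactly the
  polynomials in the coordinates.
\<close>

inductive semialgebraic :: "'a::euclidean_space set \<Rightarrow> bool" where
  positive: "real_polynomial_function p \<Longrightarrow> semialgebraic {x. p x > 0}"
| complement: "semialgebraic S \<Longrightarrow> semialgebraic (- S)"
| union: "semialgebraic S \<Longrightarrow> semialgebraic T \<Longrightarrow> semialgebraic (S \<union> T)"

definition semialgebraic_on ::
    "'a::euclidean_space set \<Rightarrow> ('a \<Rightarrow> 'b::euclidean_space) \<Rightarrow> bool" where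
  "semialgebraic_on S f \<longleftrightarrow> semialgebraic {(x, f x) | x. x \<in> S}"

text \<open>
  Unlike \<^const>\<open>infdist\<close>, which is \<open>0\<close> for the empty set, this distance takes the value
  \<open>\<infinity>\<close> there.
\<close>

definition einfdist :: "'a::metric_space \<Rightarrow> 'a set \<Rightarrow> ereal" where
  "einfdist v S = (INF w\<in>S. ereal (dist v w))"

lemma einfdist_empty: "einfdist v {} = \<infinity>"
  by (simp add: einfdist_def top_ereal_def)

lemma einfdist_eq_infdist: "S \<noteq> {} \<Longrightarrow> einfdist v S = ereal (infdist v S)"
  unfolding einfdist_def infdist_def
  by (simp add: ereal_Inf' image_image bdd_below_image_dist)

text \<open>
  A bundle over \<open>Q\<close> is represented by a total function; only its fibers over points of \<open>Q\<close>
  are meaningful.  The limit may be taken over \<open>y \<noteq> x\<close> since \<open>v \<in> H x\<close> has distance \<open>0\<close>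
  from \<open>H x\<close>.
\<close>

definition glaeser_refine ::
    "'a::metric_space set \<Rightarrow> ('a \<Rightarrow> 'b::metric_space set) \<Rightarrow> 'a \<Rightarrow> 'b set" where
  "glaeser_refine Q H x = {v \<in> H x. ((\<lambda>y. einfdist v (H y)) \<longlongrightarrow> 0) (at x within Q)}"

definition glaeser_iter ::
    "'a::metric_space set \<Rightarrow> ('a \<Rightarrow> 'b::metric_space set) \<Rightarrow> nat \<Rightarrow> 'a \<Rightarrow> 'b set" where
  "glaeser_iter Q H k = (glaeser_refine Q ^^ k) H"

text \<open>
  For bundles with affine fibers the refinement procedure stabilizes (Fefferman), so the
  \<open>LEAST\<close> below is attained; the choice of stabilization index does not affect the fibers
  over \<open>Q\<close>.
\<close>

definition glaeser_index ::
    "'a::metric_space set \<Rightarrow> ('a \<Rightarrow> 'b::metric_space set) \<Rightarrow> nat" where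
  "glaeser_index Q H =
     (LEAST k0. \<forall>k\<ge>k0. \<forall>x\<in>Q. glaeser_iter Q H k x = glaeser_iter Q H k0 x)"

definition glaeser_stable ::
    "'a::metric_space set \<Rightarrow> ('a \<Rightarrow> 'b::metric_space set) \<Rightarrow> 'a \<Rightarrow> 'b set" where
  "glaeser_stable Q H = glaeser_iter Q H (glaeser_index Q H)"

definition solution_bundle ::
    "('a \<Rightarrow> real ^ 's ^ 'r) \<Rightarrow> ('a \<Rightarrow> real ^ 'r) \<Rightarrow> 'a \<Rightarrow> (real ^ 's) set" where
  "solution_bundle A \<gamma> x = {v. A x *v v = \<gamma> x}"

end

theory Submission
  imports Defs
begin

text \<open>
  A continuous solution lies in every Glaeser refinement, since \<open>dist (\<phi> x) (\<phi> y) \<rightarrow> 0\<close> as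
  \<open>y \<rightarrow> x\<close>.  Conversely, let the stable refinement \<open>H\<close> have no empty fiber.  By the
  Tarski--Seidenberg theorem (proved by the method of Cohen and Hoermander) \<open>H\<close> is semialgebraic,
  and stability means that \<open>H\<close> is lower semicontinuous.  Hence the sets of points with fibers of
  dimension less than \<open>m\<close> are compact and semialgebraic.  A continuous semialgebraic selection is
  built by induction on \<open>m\<close>: extend the selection on one of these sets by a semialgebraic Tietze
  theorem and project the extension orthogonally to the fibers over the next one.  The projection
  is continuous at the new points because the fibers have constant dimension there, and at the
  old points because the extension already takes its values in the fibers.
\<close>

section \<open>Semialgebraic sets\<close>

text \<open>Quantifiers are eliminated without a syntax of formulas: a projection is semialgebraic
  once it is invariant under agreement of parameters on finitely many semialgebraic sets, so no
  explicit description of it is ever produced. Invariance is shown by an increasing bijection of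
  \<open>[0, 1]\<close> carrying the sign pattern over one parameter to that over another. A compact
  interval avoids any discussion of behaviour at infinity; the rest of the line is reached by
  reflection and inversion. For the bundle the obstacle is that stability bounds the fibers from one
  side only: every point of a fiber is approximated by nearby fibers, but these may be larger, so
  limits of their points may leave the fiber, and projection to the fibers is discontinuous in
  general. The missing bound comes from dimensions: a lower limit of affine subspaces cannot have
  larger dimension than the subspaces near the limit, so it equals the limit fiber if the dimension
  does not jump. The same inequality yields the stabilization of the refinements, which must be
  proved before the \<open>LEAST\<close> in \<open>glaeser_index\<close> means anything.\<close>

named_theorems semialgebraic_intros

lemma semialgebraic_not [semialgebraic_intros]:
  "semialgebraic {x. P x} \<Longrightarrow> semialgebraic {x. \<not> P x}"
  using semialgebraic.complement [of "{x. P x}"] by (simp add: Collect_neg_eq)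

lemma semialgebraic_disj [semialgebraic_intros]:
  "semialgebraic {x. P x} \<Longrightarrow> semialgebraic {x. R x} \<Longrightarrow> semialgebraic {x. P x \<or> R x}"
  using semialgebraic.union [of "{x. P x}" "{x. R x}"] by (simp add: Collect_disj_eq)

lemma semialgebraic_conj [semialgebraic_intros]:
  assumes "semialgebraic {x. P x}" and "semialgebraic {x. R x}"
  shows "semialgebraic {x. P x \<and> R x}"
proof -
  have "semialgebraic {x. \<not> (\<not> P x \<or> \<not> R x)}"
    by (intro semialgebraic_not semialgebraic_disj assms)
  then show ?thesis by simp
qed

lemma semialgebraic_imp [semialgebraic_intros]:
  assumes "semialgebraic {x. P x}" and "semialgebraic {x. R x}"
  shows "semialgebraic {x. P x \<longrightarrow> R x}"
proof -
  have "semialgebraic {x. \<not> P x \<or> R x}"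
    by (intro semialgebraic_not semialgebraic_disj assms)
  then show ?thesis by simp
qed

lemma semialgebraic_gt: "real_polynomial_function p \<Longrightarrow> semialgebraic {x. 0 < p x}"
  by (rule semialgebraic.positive)

lemma semialgebraic_lt:
  assumes "real_polynomial_function p"
  shows "semialgebraic {x. p x < 0}"
proof -
  have "semialgebraic {x. 0 < - p x}"
    by (intro semialgebraic_gt real_polynomial_function_minus assms)
  then show ?thesis by simp
qed

lemma semialgebraic_eq0:
  assumes "real_polynomial_function p"
  shows "semialgebraic {x. p x = 0}"
proof -
  have "semialgebraic {x. \<not> (0 < p x \<or> p x < 0)}"
    by (intro semialgebraic_not semialgebraic_disj semialgebraic_gt semialgebraic_lt assms)
  moreover have "{x. \<not> (0 < p x \<or> p x < 0)} = {x. p x = 0}" by auto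
  ultimately show ?thesis by simp
qed

lemma semialgebraic_const [semialgebraic_intros]: "semialgebraic {x. c}"
proof (cases c)
  case True
  have "semialgebraic {x::'a. 0 < (1::real)}"
    by (rule semialgebraic.positive, rule real_polynomial_function.intros(2))
  then show ?thesis using True by simp
next
  case False
  have "semialgebraic {x::'a. 0 < (0::real)}"
    by (rule semialgebraic.positive, rule real_polynomial_function.intros(2))
  then show ?thesis using False by simp
qed

lemma semialgebraic_empty: "semialgebraic {}"
  using semialgebraic_const [of False] by simp

lemma semialgebraic_Bex_finite:
  assumes "finite I" and "\<And>i. i \<in> I \<Longrightarrow> semialgebraic {x. P i x}"
  shows "semialgebraic {x. \<exists>i\<in>I. P i x}"
  using assms
proof (induction rule: finite_induct)
  case empty
  then show ?case by (simp add: semialgebraic_empty)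
next
  case (insert i I)
  then have "semialgebraic {x. P i x \<or> (\<exists>i\<in>I. P i x)}"
    by (intro semialgebraic_disj) auto
  then show ?case by simp
qed

lemma semialgebraic_Ball_finite:
  assumes "finite I" and "\<And>i. i \<in> I \<Longrightarrow> semialgebraic {x. P i x}"
  shows "semialgebraic {x. \<forall>i\<in>I. P i x}"
proof -
  have "semialgebraic {x. \<not> (\<exists>i\<in>I. \<not> P i x)}"
    by (intro semialgebraic_not semialgebraic_Bex_finite assms)
  then show ?thesis by simp
qed

lemma semialgebraic_vimage_polynomial:
  fixes f :: "'a::euclidean_space \<Rightarrow> 'b::euclidean_space"
  assumes "polynomial_function f" and "semialgebraic S"
  shows "semialgebraic {x. f x \<in> S}"
  using assms(2)
proof induction
  case (positive p)
  then have "real_polynomial_function (p \<circ> f)"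
    by (intro real_polynomial_function_compose assms(1))
  then show ?case
    using semialgebraic_gt [of "p \<circ> f"] by simp
next
  case (complement S)
  then show ?case by (simp add: semialgebraic_not)
next
  case (union S T)
  then show ?case by (simp add: semialgebraic_disj)
qed

lemma semialgebraic_vimage_linear:
  fixes f :: "'a::euclidean_space \<Rightarrow> 'b::euclidean_space"
  assumes "bounded_linear f" and "semialgebraic S"
  shows "semialgebraic {x. f x \<in> S}"
  by (intro semialgebraic_vimage_polynomial polynomial_function_bounded_linear assms)

text \<open>A set invariant under agreement on \<open>\<A>\<close> is a union of atoms of the
  Boolean algebra generated by \<open>\<A>\<close>, and there are only finitely many atoms. This
  turns an invariance argument into quantifier elimination, since \<open>P\<close> itself may
  contain quantifiers.\<close>

lemma semialgebraic_atoms: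
  assumes "finite \<A>" and "\<And>A. A \<in> \<A> \<Longrightarrow> semialgebraic A"
    and "\<And>x x'. (\<And>A. A \<in> \<A> \<Longrightarrow> x \<in> A \<longleftrightarrow> x' \<in> A) \<Longrightarrow> P x \<Longrightarrow> P x'"
  shows "semialgebraic {x. P x}"
proof -
  \<comment> \<open>The membership patterns in \<open>\<A>\<close> realised by points that satisfy
    \<open>P\<close>.\<close>
  define T where "T = {\<B>. \<B> \<subseteq> \<A> \<and> (\<exists>x. P x \<and> {A\<in>\<A>. x \<in> A} = \<B>)}"
  have "finite T"
    unfolding T_def using assms(1) by (auto intro: finite_subset [of _ "Pow \<A>"])
  then have "semialgebraic {x. \<exists>\<B>\<in>T. \<forall>A\<in>\<A>. (A \<in> \<B> \<longrightarrow> x \<in> A) \<and> (A \<notin> \<B> \<longrightarrow> x \<notin> A)}"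
    by (intro semialgebraic_Bex_finite semialgebraic_Ball_finite assms(1) semialgebraic_intros)
      (auto simp: assms(2))
  moreover have "(\<exists>\<B>\<in>T. \<forall>A\<in>\<A>. (A \<in> \<B> \<longrightarrow> x \<in> A) \<and> (A \<notin> \<B> \<longrightarrow> x \<notin> A)) \<longleftrightarrow> P x" for x
  proof
    assume "P x"
    then have "{A\<in>\<A>. x \<in> A} \<in> T" by (auto simp: T_def)
    then show "\<exists>\<B>\<in>T. \<forall>A\<in>\<A>. (A \<in> \<B> \<longrightarrow> x \<in> A) \<and> (A \<notin> \<B> \<longrightarrow> x \<notin> A)"
      by (rule bexI [rotated]) auto
  next
    assume "\<exists>\<B>\<in>T. \<forall>A\<in>\<A>. (A \<in> \<B> \<longrightarrow> x \<in> A) \<and> (A \<notin> \<B> \<longrightarrow> x \<notin> A)"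
    then obtain y where "P y" "\<forall>A\<in>\<A>. y \<in> A \<longleftrightarrow> x \<in> A"
      unfolding T_def by auto
    then show "P x" using assms(3) [of y x] by auto
  qed
  ultimately show ?thesis by simp
qed

section \<open>Order isomorphisms of intervals respecting a relation\<close>

text \<open>Strict monotonicity together with surjectivity makes \<open>h\<close> a homeomorphism
  taking endpoints to endpoints, so that matchings of adjacent intervals can be glued.\<close>

definition order_match :: "(real \<Rightarrow> real \<Rightarrow> bool) \<Rightarrow> real \<Rightarrow> real \<Rightarrow> real \<Rightarrow> real \<Rightarrow> bool" where
  "order_match R a b a' b' \<longleftrightarrow>
     (\<exists>h. strict_mono_on {a..b} h \<and> h ` {a..b} = {a'..b'} \<and> (\<forall>t\<in>{a..b}. R t (h t)))"

lemma strict_mono_on_interval_endpoints: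
  fixes h :: "real \<Rightarrow> real"
  assumes "strict_mono_on {a..b} h" and "h ` {a..b} = {a'..b'}" and "a \<le> b"
  shows "h a = a'" and "h b = b'"
proof -
  have m: "mono_on {a..b} h"
    using assms(1) by (rule strict_mono_on_imp_mono_on)
  have "h a \<in> {a'..b'}" "h b \<in> {a'..b'}"
    using assms(2,3) by auto
  then have "a' \<in> h ` {a..b}" "b' \<in> h ` {a..b}"
    using assms(2) by auto
  then obtain s t where st: "s \<in> {a..b}" "h s = a'" "t \<in> {a..b}" "h t = b'"
    by blast
  have "h a \<le> h s" "h t \<le> h b"
    using m st assms(3) by (auto simp: monotone_on_def)
  then show "h a = a'" "h b = b'"
    using st \<open>h a \<in> _\<close> \<open>h b \<in> _\<close> by auto
qed

text \<open>The affine bijection suffices: \<open>R\<close> is assumed for all pairs of interior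
  points, so only the endpoints need care.\<close>

lemma order_match_linear:
  assumes "a < b" "a' < b'" and "R a a'" "R b b'"
    and R: "\<And>t t'. a < t \<Longrightarrow> t < b \<Longrightarrow> a' < t' \<Longrightarrow> t' < b' \<Longrightarrow> R t t'"
  shows "order_match R a b a' b'"
proof -
  define c where "c = (b' - a') / (b - a)"
  define h where "h t = a' + c * (t - a)" for t
  have c: "c > 0" "c * (b - a) = b' - a'"
    using assms by (auto simp: c_def)
  have hab: "h a = a'" "h b = b'"
    using c by (auto simp: h_def)
  have mono: "h s < h t" if "s < t" for s t
    using that c by (simp add: h_def)
  have "h ` {a..b} = {a'..b'}"
  proof
    show "h ` {a..b} \<subseteq> {a'..b'}"
    proof safe
      fix t assume "t \<in> {a..b}"
      then have "h a \<le> h t" "h t \<le> h b"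
        using mono by (auto simp: le_less)
      then show "h t \<in> {a'..b'}" by (simp add: hab)
    qed
    show "{a'..b'} \<subseteq> h ` {a..b}"
    proof
      fix y assume y: "y \<in> {a'..b'}"
      have eq: "h (a + (y - a') / c) = y" using c by (simp add: h_def)
      have "a + (y - a') / c \<in> {a..b}"
      proof -
        have "\<not> a + (y - a') / c < a" "\<not> b < a + (y - a') / c"
          using mono [of "a + (y - a') / c" a] mono [of b "a + (y - a') / c"] y hab eq by auto
        then show ?thesis by auto
      qed
      from this eq [symmetric] show "y \<in> h ` {a..b}" by (rule rev_image_eqI)
    qed
  qed
  moreover have "strict_mono_on {a..b} h"
    using mono by (auto simp: strict_mono_on_def)
  moreover have "R t (h t)" if "t \<in> {a..b}" for t
  proof (cases "t = a \<or> t = b")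
    case True
    then show ?thesis using assms hab by auto
  next
    case False
    then show ?thesis using R [of t "h t"] mono [of a t] mono [of t b] that hab by auto
  qed
  ultimately show ?thesis unfolding order_match_def by blast
qed

lemma order_match_glue:
  assumes "order_match R a c a' c'" and "order_match R c b c' b'" and "a \<le> c" "c \<le> b"
  shows "order_match R a b a' b'"
proof -
  from assms(1) obtain g where g: "strict_mono_on {a..c} g" "g ` {a..c} = {a'..c'}"
    "\<forall>t\<in>{a..c}. R t (g t)" unfolding order_match_def by blast
  from assms(2) obtain k where k: "strict_mono_on {c..b} k" "k ` {c..b} = {c'..b'}"
    "\<forall>t\<in>{c..b}. R t (k t)" unfolding order_match_def by blast
  have gc: "g a = a'" "g c = c'" and kc: "k c = c'" "k b = b'"
    using strict_mono_on_interval_endpoints [OF g(1,2) assms(3)]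
      strict_mono_on_interval_endpoints [OF k(1,2) assms(4)] by auto
  have le: "a' \<le> c'" "c' \<le> b'"
    using strict_mono_on_leD [OF g(1), of a c] strict_mono_on_leD [OF k(1), of c b] assms(3,4) gc kc
    by simp_all
  define h where "h t = (if t \<le> c then g t else k t)" for t
  have hk: "h t = k t" if "c \<le> t" for t
    using that gc kc by (auto simp: h_def)
  have hg: "h t = g t" if "t \<le> c" for t
    using that by (auto simp: h_def)
  have "h ` {a..c} = {a'..c'}" "h ` {c..b} = {c'..b'}"
    using g(2) k(2) hg hk by auto
  moreover have "{a..b} = {a..c} \<union> {c..b}" "{a'..b'} = {a'..c'} \<union> {c'..b'}"
    using assms(3,4) le by auto
  ultimately have "h ` {a..b} = {a'..b'}"
    by (simp only: image_Un)
  moreover have "h s < h t" if st: "s \<in> {a..b}" "t \<in> {a..b}" "s < t" for s t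
  proof -
    consider "t \<le> c" | "c \<le> s" | "s < c" "c < t" by linarith
    then show ?thesis
    proof cases
      case 1
      then show ?thesis using g(1) st hg by (auto simp: strict_mono_on_def)
    next
      case 2
      then show ?thesis using k(1) st hk by (auto simp: strict_mono_on_def)
    next
      case 3
      then have "g s < g c" "k c < k t"
        using g(1) k(1) st by (auto simp: strict_mono_on_def)
      then show ?thesis using 3 gc kc by (simp add: h_def)
    qed
  qed
  moreover have "R t (h t)" if "t \<in> {a..b}" for t
    using that g(3) k(3) by (auto simp: h_def)
  ultimately show ?thesis unfolding order_match_def strict_mono_on_def by blast
qed

text \<open>A strictly increasing function has at most one zero, and the signs at the endpoints
  decide whether there is one in the interior. If so, the zeros of \<open>f\<close> and
  \<open>f'\<close> are matched and the two halves glued; otherwise the affine matching works. The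
  relation \<open>S\<close> carries the signs of the other members of a family along.\<close>

lemma order_match_increasing:
  fixes f f' :: "real \<Rightarrow> real"
  assumes ab: "a < b" "a' < b'"
    and mono: "strict_mono_on {a..b} f" "strict_mono_on {a'..b'} f'"
    and cont: "continuous_on {a..b} f" "continuous_on {a'..b'} f'"
    and sgn: "sgn (f a) = sgn (f' a')" "sgn (f b) = sgn (f' b')"
    and S: "S a a'" "S b b'"
      "\<And>t t'. a < t \<Longrightarrow> t < b \<Longrightarrow> a' < t' \<Longrightarrow> t' < b' \<Longrightarrow> S t t'"
  shows "order_match (\<lambda>t t'. sgn (f t) = sgn (f' t') \<and> S t t') a b a' b'" (is "order_match ?R _ _ _ _")
proof -
  have lt: "f s < f t" if "a \<le> s" "s < t" "t \<le> b" for s t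
    using mono(1) that by (auto simp: strict_mono_on_def)
  have lt': "f' s < f' t" if "a' \<le> s" "s < t" "t \<le> b'" for s t
    using mono(2) that by (auto simp: strict_mono_on_def)
  have neg: "f' a' < 0 \<longleftrightarrow> f a < 0" and pos: "0 < f' b' \<longleftrightarrow> 0 < f b"
    using sgn_less [of "f a"] sgn_less [of "f' a'"] sgn_greater [of "f b"] sgn_greater [of "f' b'"]
    unfolding sgn by blast+
  consider "0 \<le> f a" | "f b \<le> 0" | "f a < 0" "0 < f b" by linarith
  then show ?thesis
  proof cases
    case 1
    then have "0 \<le> f' a'" using neg by linarith
    have "?R t t'" if "a < t" "t < b" "a' < t'" "t' < b'" for t t'
      using lt [of a t] lt' [of a' t'] that 1 \<open>0 \<le> f' a'\<close> S(3) [of t t'] by simp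
    then show ?thesis using ab sgn S(1,2) by (intro order_match_linear) blast+
  next
    case 2
    then have "f' b' \<le> 0" using pos by linarith
    have "?R t t'" if "a < t" "t < b" "a' < t'" "t' < b'" for t t'
      using lt [of t b] lt' [of t' b'] that 2 \<open>f' b' \<le> 0\<close> S(3) [of t t'] by simp
    then show ?thesis using ab sgn S(1,2) by (intro order_match_linear) blast+
  next
    case 3
    then have neg': "f' a' < 0" "0 < f' b'" using neg pos by blast+
    obtain c where c: "a \<le> c" "c \<le> b" "f c = 0"
      using IVT' [of f a 0 b] 3 ab cont by auto
    obtain c' where c': "a' \<le> c'" "c' \<le> b'" "f' c' = 0"
      using IVT' [of f' a' 0 b'] neg' ab cont by auto
    have ne: "a < c" "c < b" "a' < c'" "c' < b'"
      using c c' 3 neg' by (auto simp: less_le)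
    have R: "?R a a'" "?R c c'" "?R b b'"
      using S sgn ne c c' by simp_all
    have "?R t t'" if "a < t" "t < c" "a' < t'" "t' < c'" for t t'
      using lt [of t c] lt' [of t' c'] that c c' S(3) [of t t'] ne by simp
    then have "order_match ?R a c a' c'"
      by (intro order_match_linear ne R) blast
    moreover have "?R t t'" if "c < t" "t < b" "c' < t'" "t' < b'" for t t'
      using lt [of c t] lt' [of c' t'] that c c' S(3) [of t t'] ne by simp
    then have "order_match ?R c b c' b'"
      by (intro order_match_linear ne R) blast
    ultimately show ?thesis using c(1,2) by (rule order_match_glue)
  qed
qed

lemma order_match_decreasing:
  fixes f f' :: "real \<Rightarrow> real"
  assumes "a < b" "a' < b'"
    and "strict_mono_on {a..b} (\<lambda>t. - f t)" "strict_mono_on {a'..b'} (\<lambda>t. - f' t)"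
    and "continuous_on {a..b} f" "continuous_on {a'..b'} f'"
    and "sgn (f a) = sgn (f' a')" "sgn (f b) = sgn (f' b')"
    and "S a a'" "S b b'"
      "\<And>t t'. a < t \<Longrightarrow> t < b \<Longrightarrow> a' < t' \<Longrightarrow> t' < b' \<Longrightarrow> S t t'"
  shows "order_match (\<lambda>t t'. sgn (f t) = sgn (f' t') \<and> S t t') a b a' b'"
proof -
  have "order_match (\<lambda>t t'. sgn (- f t) = sgn (- f' t') \<and> S t t') a b a' b'"
    using assms by (intro order_match_increasing) (auto intro: continuous_on_minus simp: sgn_minus)
  then show ?thesis by (simp add: sgn_minus)
qed

text \<open>The number of points of \<open>Z\<close> strictly between the ends drops on both sides
  of an intermediate point. This reduces a matching on \<open>[0, 1]\<close> to the gaps between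
  consecutive zeros.\<close>

lemma interval_partition_induct:
  fixes Z :: "real set"
  assumes "finite Z"
    and gap: "\<And>a b. a \<in> Z \<Longrightarrow> b \<in> Z \<Longrightarrow> a < b \<Longrightarrow> Z \<inter> {a<..<b} = {} \<Longrightarrow> P a b"
    and glue: "\<And>a b c. a \<in> Z \<Longrightarrow> b \<in> Z \<Longrightarrow> a < c \<Longrightarrow> c < b \<Longrightarrow> P a c \<Longrightarrow> P c b \<Longrightarrow> P a b"
    and "a \<in> Z" "b \<in> Z" "a < b"
  shows "P a b"
  using assms(4-)
proof (induction "card (Z \<inter> {a<..<b})" arbitrary: a b rule: less_induct)
  case less
  show ?case
  proof (cases "Z \<inter> {a<..<b} = {}")
    case True
    then show ?thesis using gap less.prems by blast
  next
    case False
    then obtain c where c: "c \<in> Z" "a < c" "c < b" by auto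
    have fin: "finite (Z \<inter> {a<..<b})" using assms(1) by simp
    have "Z \<inter> {a<..<c} \<subset> Z \<inter> {a<..<b}" "Z \<inter> {c<..<b} \<subset> Z \<inter> {a<..<b}"
      using c by auto
    then have "card (Z \<inter> {a<..<c}) < card (Z \<inter> {a<..<b})"
      "card (Z \<inter> {c<..<b}) < card (Z \<inter> {a<..<b})"
      by (simp_all add: psubset_card_mono [OF fin])
    then show ?thesis using less c glue by blast
  qed
qed

section \<open>Sign diagrams of parametrised polynomials\<close>

text \<open>The number \<open>n\<close> bounds the count of coefficients, not the degree, so that
  only the zero polynomial is left for \<open>n = 0\<close> and inductions can start there. The
  actual degree may drop at particular parameters.\<close>

definition poly_family :: "nat \<Rightarrow> ('a::euclidean_space \<Rightarrow> real poly) \<Rightarrow> bool" where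
  "poly_family n p \<longleftrightarrow>
     (\<forall>i. real_polynomial_function (\<lambda>x. coeff (p x) i)) \<and> (\<forall>x. \<forall>i\<ge>n. coeff (p x) i = 0)"

lemma poly_family_mono: "poly_family m p \<Longrightarrow> m \<le> n \<Longrightarrow> poly_family n p"
  by (auto simp: poly_family_def)

lemma poly_family_0: "poly_family 0 p \<Longrightarrow> p x = 0"
  by (simp add: poly_family_def poly_eq_iff)

lemma poly_family_eval:
  assumes "poly_family n p"
  shows "poly (p x) t = (\<Sum>i<n. coeff (p x) i * t ^ i)"
proof -
  show ?thesis
  proof (cases "p x = 0")
    case False
    have "\<not> n \<le> degree (p x)"
    proof
      assume "n \<le> degree (p x)"
      then have "lead_coeff (p x) = 0" using assms unfolding poly_family_def by blast
      then show False using False by simp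
    qed
    then have "{..degree (p x)} \<subseteq> {..<n}" by auto
    then show ?thesis
      unfolding poly_altdef by (intro sum.mono_neutral_left) (auto simp: coeff_eq_0)
  qed simp
qed

lemma poly_family_poly:
  assumes "poly_family n p"
  shows "real_polynomial_function (\<lambda>x. poly (p x) t)"
  unfolding poly_family_eval [OF assms]
  by (intro real_polynomial_function_sum real_polynomial_function.intros(4) real_polynomial_function.intros(2))
    (use assms in \<open>auto simp: poly_family_def\<close>)

lemma poly_family_pderiv:
  assumes "poly_family (Suc n) p"
  shows "poly_family n (\<lambda>x. pderiv (p x))"
  using assms unfolding poly_family_def coeff_pderiv
  by (auto intro!: real_polynomial_function.intros(4) real_polynomial_function.intros(2))

text \<open>The degree of \<open>q x\<close> varies with the parameter, so a remainder is built for
  each prospective degree \<open>k\<close>: multiples of \<open>q\<close> cancel the top coefficient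
  of \<open>p\<close> until only \<open>k\<close> coefficients remain. At a zero of \<open>q\<close>
  the subtracted multiples vanish.\<close>

lemma poly_family_pseudo_rem:
  assumes p: "poly_family n p" and q: "poly_family m q"
  obtains r where "poly_family k r"
    and "\<And>x t. q x \<noteq> 0 \<Longrightarrow> degree (q x) = k \<Longrightarrow> poly (q x) t = 0 \<Longrightarrow>
           sgn (poly (r x) t) = sgn (poly (p x) t)"
proof -
  have "\<exists>r. poly_family k r \<and> (\<forall>x t. q x \<noteq> 0 \<longrightarrow> degree (q x) = k \<longrightarrow> poly (q x) t = 0 \<longrightarrow>
           sgn (poly (r x) t) = sgn (poly (p x) t))"
    using p
  proof (induction n arbitrary: p)
    case 0
    then show ?case using poly_family_mono by blast
  next
    case (Suc n)
    show ?case
    proof (cases "Suc n \<le> k")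
      case True
      then show ?thesis using Suc.prems poly_family_mono by blast
    next
      case False
      then have kn: "k \<le> n" by simp
      define c where "c x = coeff (q x) k" for x
      define a where "a x = coeff (p x) n" for x
      \<comment> \<open>multiplying by the square of the leading coefficient does not change the sign of \<open>p\<close>\<close>
      define p1 where "p1 x = smult (c x * c x) (p x)
        - smult (c x * a x) (monom 1 (n - k) * poly_cutoff (Suc k) (q x))" for x
      have coeff: "coeff (p1 x) i = c x * c x * coeff (p x) i
         - c x * a x * (if i < n - k \<or> n < i then 0 else coeff (q x) (i - (n - k)))" for x i
        using kn by (auto simp: p1_def coeff_monom_mult coeff_poly_cutoff)
      have rq: "real_polynomial_function (\<lambda>x. coeff (q x) i)" for i
        using q by (simp add: poly_family_def)
      have rp: "real_polynomial_function (\<lambda>x. coeff (p x) i)" for i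
        using Suc.prems by (simp add: poly_family_def)
      have "real_polynomial_function (\<lambda>x. coeff (p1 x) i)" for i
      proof -
        have "real_polynomial_function (\<lambda>x. if i < n - k \<or> n < i then 0 else coeff (q x) (i - (n - k)))"
          by (cases "i < n - k \<or> n < i") (simp_all add: rq real_polynomial_function.intros(2) del: not_less)
        then show ?thesis
          unfolding coeff c_def a_def
          by (intro real_polynomial_function_diff real_polynomial_function.intros(4) rp rq)
      qed
      moreover have "coeff (p1 x) i = 0" if "i \<ge> n" for x i
      proof (cases "i = n")
        case True
        then show ?thesis using kn by (simp add: coeff a_def c_def)
      next
        case False
        then have "coeff (p x) i = 0" using Suc.prems that by (simp add: poly_family_def)
        then show ?thesis using False that by (simp add: coeff)
      qed
      ultimately have "poly_family n p1" by (simp add: poly_family_def)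
      from Suc.IH [OF this] obtain r where r: "poly_family k r"
        "\<And>x t. q x \<noteq> 0 \<Longrightarrow> degree (q x) = k \<Longrightarrow> poly (q x) t = 0 \<Longrightarrow>
           sgn (poly (r x) t) = sgn (poly (p1 x) t)" by blast
      have "sgn (poly (r x) t) = sgn (poly (p x) t)"
        if x: "q x \<noteq> 0" "degree (q x) = k" "poly (q x) t = 0" for x t
      proof -
        \<comment> \<open>The truncation keeps the coefficients of \<open>p1 x\<close> from
          \<open>n\<close> on zero even where \<open>q x\<close> has degree above \<open>k\<close>;
          at degree exactly \<open>k\<close> it changes nothing.\<close>
        have "poly_cutoff (Suc k) (q x) = q x"
          using x(2) by (auto simp: poly_eq_iff coeff_poly_cutoff coeff_eq_0)
        then have "poly (p1 x) t = (c x * c x) * poly (p x) t"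
          using x(3) by (simp add: p1_def)
        moreover have "c x * c x > 0"
        proof -
          have "c x \<noteq> 0" using x by (auto simp: c_def)
          then show ?thesis using not_real_square_gt_zero by blast
        qed
        ultimately have "sgn (poly (p1 x) t) = sgn (poly (p x) t)"
          by (metis sgn_mult sgn_pos mult_1)
        then show ?thesis using r(2) [OF x] by simp
      qed
      then show ?thesis using r(1) by blast
    qed
  qed
  then show ?thesis using that by blast
qed

definition sgn_match :: "('a \<Rightarrow> real poly) set \<Rightarrow> 'a \<Rightarrow> 'a \<Rightarrow> real \<Rightarrow> real \<Rightarrow> bool" where
  "sgn_match F x x' t t' \<longleftrightarrow> (\<forall>p\<in>F. sgn (poly (p x) t) = sgn (poly (p x') t'))"

text \<open>Finitely many semialgebraic conditions on the parameter determine the sign diagram of the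
  family on \<open>[0, 1]\<close> up to reparametrisation.\<close>

definition sgn_determined :: "('a::euclidean_space \<Rightarrow> real poly) set \<Rightarrow> bool" where
  "sgn_determined F \<longleftrightarrow> (\<exists>\<A>. finite \<A> \<and> (\<forall>A\<in>\<A>. semialgebraic A) \<and>
     (\<forall>x x'. (\<forall>A\<in>\<A>. x \<in> A \<longleftrightarrow> x' \<in> A) \<longrightarrow> order_match (sgn_match F x x') 0 1 0 1))"

lemma poly_sgn_constant_on_interval:
  fixes p :: "real poly"
  assumes "\<And>t. a < t \<Longrightarrow> t < b \<Longrightarrow> poly p t \<noteq> 0"
    and "a < s" "s < b" "a < t" "t < b"
  shows "sgn (poly p s) = sgn (poly p t)"
proof -
  have "sgn (poly p s) = sgn (poly p t)" if st: "a < s" "s < t" "t < b" for s t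
  proof (rule ccontr)
    assume ne: "sgn (poly p s) \<noteq> sgn (poly p t)"
    have "poly p s \<noteq> 0" "poly p t \<noteq> 0" using assms(1) st by auto
    then have "poly p s < 0 \<and> 0 < poly p t \<or> 0 < poly p s \<and> poly p t < 0"
      using ne by (auto simp: sgn_if split: if_splits)
    then obtain u where "s < u" "u < t" "poly p u = 0"
      using poly_IVT_pos [of s t p] poly_IVT_neg [of s t p] st by blast
    then show False using assms(1) [of u] st by auto
  qed
  then show ?thesis using assms(2-) by (metis linorder_neqE)
qed

lemma poly_strict_mono_on:
  fixes p :: "real poly"
  assumes "\<And>t. a < t \<Longrightarrow> t < b \<Longrightarrow> 0 < poly (pderiv p) t"
  shows "strict_mono_on {a..b} (poly p)"
proof (rule strict_mono_onI)
  fix s t assume st: "s \<in> {a..b}" "t \<in> {a..b}" "s < t"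
  show "poly p s < poly p t"
  proof (rule DERIV_pos_imp_increasing_open [OF st(3)])
    fix u assume "s < u" "u < t"
    then have "0 < poly (pderiv p) u" using assms st by auto
    then show "\<exists>y. DERIV (poly p) u :> y \<and> 0 < y" using poly_DERIV by blast
  qed (intro continuous_intros)
qed

text \<open>On the gap the derivative of \<open>P\<close> vanishes identically or has constant sign,
  and \<open>der\<close> gives the derivative of \<open>P'\<close> that same sign. So both
  polynomials are constant, or both are strictly monotone in the same direction.\<close>

lemma order_match_poly_gap:
  fixes P P' :: "real poly"
  assumes ab: "a < b" "a' < b'"
    and P0: "pderiv P = 0 \<longleftrightarrow> pderiv P' = 0"
    and nz: "\<And>t. pderiv P \<noteq> 0 \<Longrightarrow> a < t \<Longrightarrow> t < b \<Longrightarrow> poly (pderiv P) t \<noteq> 0"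
    and der: "\<And>t t'. a < t \<Longrightarrow> t < b \<Longrightarrow> a' < t' \<Longrightarrow> t' < b' \<Longrightarrow>
      sgn (poly (pderiv P) t) = sgn (poly (pderiv P') t')"
    and sgn: "sgn (poly P a) = sgn (poly P' a')" "sgn (poly P b) = sgn (poly P' b')"
    and S: "S a a'" "S b b'"
      "\<And>t t'. a < t \<Longrightarrow> t < b \<Longrightarrow> a' < t' \<Longrightarrow> t' < b' \<Longrightarrow> S t t'"
  shows "order_match (\<lambda>t t'. sgn (poly P t) = sgn (poly P' t') \<and> S t t') a b a' b'"
proof -
  have cont: "continuous_on {a..b} (poly P)" "continuous_on {a'..b'} (poly P')"
    by (intro continuous_intros)+
  \<comment> \<open>The midpoints are sample points: comparing every point with a fixed one through
    \<open>der\<close> shows that the signs are constant.\<close>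
  define m where "m = (a + b) / 2"
  have m: "a < m" "m < b" using ab by (auto simp: m_def)
  define m' where "m' = (a' + b') / 2"
  have m': "a' < m'" "m' < b'" using ab by (auto simp: m'_def)
  consider "pderiv P = 0" | "0 < poly (pderiv P) m" "pderiv P \<noteq> 0"
    | "poly (pderiv P) m < 0" "pderiv P \<noteq> 0"
    using nz [OF _ m] by fastforce
  then show ?thesis
  proof cases
    case 1
    then obtain c c' where "P = [:c:]" "P' = [:c':]"
      using P0 by (metis pderiv_iszero)
    then show ?thesis
      using ab sgn S by (intro order_match_linear) simp_all
  next
    case 2
    have sg: "sgn (poly (pderiv P) t) = sgn (poly (pderiv P) m)" if "a < t" "t < b" for t
      using der [OF that m'] der [OF m m'] by simp
    have "0 < poly (pderiv P) t" if "a < t" "t < b" for t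
      using sg [OF that] 2 sgn_greater by metis
    moreover have "0 < poly (pderiv P') t'" if "a' < t'" "t' < b'" for t'
      using der [OF m that] 2 sgn_greater by metis
    ultimately show ?thesis
      by (intro order_match_increasing ab sgn S poly_strict_mono_on cont)
  next
    case 3
    have sg: "sgn (poly (pderiv P) t) = sgn (poly (pderiv P) m)" if "a < t" "t < b" for t
      using der [OF that m'] der [OF m m'] by simp
    have "poly (pderiv P) t < 0" if "a < t" "t < b" for t
      using sg [OF that] 3 sgn_less by metis
    then have "strict_mono_on {a..b} (poly (- P))"
      by (intro poly_strict_mono_on) (simp add: pderiv_minus)
    moreover have "poly (pderiv P') t' < 0" if "a' < t'" "t' < b'" for t'
      using der [OF m that] 3 sgn_less by metis
    then have "strict_mono_on {a'..b'} (poly (- P'))"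
      by (intro poly_strict_mono_on) (simp add: pderiv_minus)
    ultimately show ?thesis
      by (intro order_match_decreasing ab sgn S cont) (simp_all add: poly_minus [abs_def])
  qed
qed

text \<open>
  The zeros of the members of \<open>E\<close> and of the derivative of \<open>p\<close> cut \<open>[0, 1]\<close> into intervals on
  which \<open>p\<close> is strictly monotone or constant.  At such a zero of \<open>q\<close> the sign of \<open>p\<close> is that of a
  pseudo-remainder of \<open>p\<close> by \<open>q\<close>, so an order isomorphism respecting the signs of the
  pseudo-remainders can be corrected between the zeros to respect the sign of \<open>p\<close>.
\<close>

lemma sgn_determined_insert:
  fixes p :: "'a::euclidean_space \<Rightarrow> real poly"
  assumes det: "sgn_determined E'" and E': "E \<subseteq> E'" "(\<lambda>x. pderiv (p x)) \<in> E'"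
    and p: "poly_family n p" and E: "finite E" "\<And>q. q \<in> E \<Longrightarrow> poly_family n q"
    and rem: "\<And>q k. q \<in> insert (\<lambda>x. pderiv (p x)) E \<Longrightarrow> k < n \<Longrightarrow> \<exists>r\<in>E'. \<forall>x t.
      q x \<noteq> 0 \<longrightarrow> degree (q x) = k \<longrightarrow> poly (q x) t = 0 \<longrightarrow> sgn (poly (r x) t) = sgn (poly (p x) t)"
  shows "sgn_determined (insert p E)"
proof -
  define p' where "p' = (\<lambda>x. pderiv (p x))"
  define D where "D = insert p' E"
  have finD: "finite D" using E by (simp add: D_def)
  have D: "poly_family n q" if "q \<in> D" for q
  proof (cases "q \<in> E")
    case False
    then have "q = p'" using that by (simp add: D_def)
    moreover have "poly_family (Suc n) p" using p poly_family_mono by fastforce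
    ultimately show ?thesis using poly_family_pderiv p'_def by blast
  qed (use E in auto)
  have DE': "D \<subseteq> E'" using E' by (auto simp: D_def p'_def)
  obtain \<A> where \<A>: "finite \<A>" "\<forall>A\<in>\<A>. semialgebraic A"
    "\<And>x x'. (\<forall>A\<in>\<A>. x \<in> A \<longleftrightarrow> x' \<in> A) \<Longrightarrow> order_match (sgn_match E' x x') 0 1 0 1"
    using det unfolding sgn_determined_def by blast
  \<comment> \<open>These conditions fix which of the \<open>q x\<close> vanish identically and the
    degrees of the others, and hence which remainder applies.\<close>
  define \<B> where "\<B> = (\<lambda>(q, i). {x. coeff (q x) i = 0}) ` (D \<times> {..<n})"
  \<comment> \<open>The endpoints need not be zeros of any \<open>q\<close>, so no remainder gives
    the sign of \<open>p\<close> there; it is prescribed directly.\<close>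
  define \<C> where "\<C> = (\<lambda>t. {x. 0 < poly (p x) t}) ` {0, 1} \<union> (\<lambda>t. {x. poly (p x) t < 0}) ` {0, 1}"
  have "finite (\<A> \<union> \<B> \<union> \<C>)"
    using \<A> finD by (simp add: \<B>_def \<C>_def)
  moreover have "\<forall>A\<in>\<A> \<union> \<B> \<union> \<C>. semialgebraic A"
  proof -
    have "\<forall>A\<in>\<B>. semialgebraic A"
      unfolding \<B>_def using D by (auto simp: poly_family_def intro!: semialgebraic_eq0)
    moreover have "\<forall>A\<in>\<C>. semialgebraic A"
      unfolding \<C>_def by (auto intro!: semialgebraic_gt semialgebraic_lt poly_family_poly p)
    ultimately show ?thesis using \<A>(2) by blast
  qed
  moreover have "order_match (sgn_match (insert p E) x x') 0 1 0 1"
    if atoms: "\<forall>A\<in>\<A> \<union> \<B> \<union> \<C>. x \<in> A \<longleftrightarrow> x' \<in> A" for x x'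
  proof -
    obtain h where h: "strict_mono_on {0..1} h" "h ` {0..1} = {0..1}"
      "\<forall>t\<in>{0..1}. sgn_match E' x x' t (h t)"
      using \<A>(3) [of x x'] atoms unfolding order_match_def by blast
    have h01: "h 0 = 0" "h 1 = 1"
      using strict_mono_on_interval_endpoints [OF h(1,2)] by auto
    have hsgn: "sgn (poly (q x) t) = sgn (poly (q x') (h t))" if "q \<in> E'" "t \<in> {0..1}" for q t
      using h(3) that by (auto simp: sgn_match_def)
    have coeff0: "coeff (q x) i = 0 \<longleftrightarrow> coeff (q x') i = 0" if "q \<in> D" for q i
    proof (cases "i < n")
      case True
      then have "{x. coeff (q x) i = 0} \<in> \<B>" using that by (force simp: \<B>_def)
      then have "x \<in> {x. coeff (q x) i = 0} \<longleftrightarrow> x' \<in> {x. coeff (q x) i = 0}"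
        by (intro atoms [rule_format] UnI1 UnI2)
      then show ?thesis by simp
    next
      case False
      then show ?thesis using D [OF that] by (simp add: poly_family_def)
    qed
    have q0: "q x = 0 \<longleftrightarrow> q x' = 0" if "q \<in> D" for q
      using coeff0 [OF that] by (simp add: poly_eq_iff)
    have deg: "degree (q x) = degree (q x')" if "q \<in> D" for q
      using coeff0 [OF that] by (simp add: degree_def)
    have end_sgn: "sgn (poly (p x) t) = sgn (poly (p x') t)" if "t \<in> {0, 1}" for t
    proof -
      have \<C>: "{x. 0 < poly (p x) t} \<in> \<C>" "{x. poly (p x) t < 0} \<in> \<C>"
        using that by (auto simp: \<C>_def)
      have "x \<in> {x. 0 < poly (p x) t} \<longleftrightarrow> x' \<in> {x. 0 < poly (p x) t}"
        "x \<in> {x. poly (p x) t < 0} \<longleftrightarrow> x' \<in> {x. poly (p x) t < 0}"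
        by (rule atoms [rule_format, OF UnI2 [OF \<C>(1)]], rule atoms [rule_format, OF UnI2 [OF \<C>(2)]])
      then show ?thesis by (auto simp: sgn_if)
    qed
    \<comment> \<open>Members that vanish identically at \<open>x\<close> are left out to keep
      \<open>Z\<close> finite; their sign is 0 everywhere and needs no cut points.\<close>
    define Z where "Z = {0, 1} \<union> (\<Union>q\<in>{q\<in>D. q x \<noteq> 0}. {t\<in>{0..1}. poly (q x) t = 0})"
    have finZ: "finite Z"
    proof -
      have "finite {t\<in>{0..1}. poly (q x) t = 0}" if "q x \<noteq> 0" for q :: "'a \<Rightarrow> real poly"
        by (rule finite_subset [OF _ poly_roots_finite [of "q x"]]) (use that in auto)
      then show ?thesis unfolding Z_def using finD by (intro finite_UnI finite_UN_I) auto
    qed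
    have Z01: "Z \<subseteq> {0..1}" by (auto simp: Z_def)
    have root_Z: "t \<in> Z" if "q \<in> D" "q x \<noteq> 0" "poly (q x) t = 0" "t \<in> {0..1}" for q t
      unfolding Z_def using that by blast
    have Zsgn: "sgn (poly (p x) t) = sgn (poly (p x') (h t))" if tZ: "t \<in> Z" for t
    proof (cases "t \<in> {0, 1}")
      case True
      then show ?thesis using end_sgn h01 by auto
    next
      case False
      then obtain q where q: "q \<in> D" "q x \<noteq> 0" "poly (q x) t = 0"
        using tZ unfolding Z_def by blast
      have t: "t \<in> {0..1}" using tZ Z01 by blast
      have "\<not> n \<le> degree (q x)"
      proof
        assume "n \<le> degree (q x)"
        then have "lead_coeff (q x) = 0" using D [OF q(1)] unfolding poly_family_def by blast
        then show False using q by simp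
      qed
      then have "degree (q x) < n" by simp
      then obtain r where r: "r \<in> E'" "\<And>y t. q y \<noteq> 0 \<Longrightarrow> degree (q y) = degree (q x) \<Longrightarrow>
          poly (q y) t = 0 \<Longrightarrow> sgn (poly (r y) t) = sgn (poly (p y) t)"
        using rem [of q "degree (q x)"] q(1) unfolding D_def p'_def by blast
      \<comment> \<open>So \<open>h t\<close> is a zero of \<open>q x'\<close>, which has the same
        degree as \<open>q x\<close>. The same \<open>r\<close> then gives the sign of
        \<open>p\<close> at both points, and \<open>h\<close> respects the sign of
        \<open>r\<close>.\<close>
      have "sgn (poly (q x) t) = sgn (poly (q x') (h t))"
        using hsgn [of q t] q(1) DE' t by blast
      then have "poly (q x') (h t) = 0" using q(3) by (simp add: sgn_zero_iff)
      then have "sgn (poly (r x') (h t)) = sgn (poly (p x') (h t))"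
        using r(2) [of x' "h t"] q0 [OF q(1)] deg [OF q(1)] q(2) by auto
      then show ?thesis
        using r(2) [OF q(2) refl q(3)] hsgn [OF r(1) t] by simp
    qed
    have mono: "h s < h t" if "s < t" "0 \<le> s" "t \<le> 1" for s t
      using h(1) that by (auto simp: strict_mono_on_def)
    define R where "R = (\<lambda>t t'. sgn (poly (p x) t) = sgn (poly (p x') t') \<and> sgn_match E x x' t t')"
    have "order_match R 0 1 (h 0) (h 1)"
    proof (rule interval_partition_induct [where Z = Z and P = "\<lambda>a b. order_match R a b (h a) (h b)"])
      fix a b assume ab: "a \<in> Z" "b \<in> Z" "a < b" "Z \<inter> {a<..<b} = {}"
      have ab01: "a \<in> {0..1}" "b \<in> {0..1}" using ab Z01 by auto
      \<comment> \<open>Pulling \<open>t'\<close> back along \<open>h\<close> gives a point of the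
        same gap, where no \<open>q x\<close> changes sign. Hence the signs agree for arbitrary
        pairs, not just for those matched by \<open>h\<close>.\<close>
      have gap: "sgn (poly (q x) t) = sgn (poly (q x') t')"
        if q: "q \<in> D" and t: "a < t" "t < b" "h a < t'" "t' < h b" for q t t'
      proof (cases "q x = 0")
        case True
        then show ?thesis using q0 [OF q] by simp
      next
        case False
        have "h a \<in> {0..1}" "h b \<in> {0..1}" using h(2) ab01 by auto
        then have "t' \<in> h ` {0..1}" using t h(2) by auto
        then obtain s where s: "s \<in> {0..1}" "h s = t'" by auto
        have "a < s"
        proof (rule ccontr)
          assume "\<not> a < s"
          then have "h s \<le> h a" using mono [of s a] s(1) ab01 by (cases "s = a") auto
          then show False using s(2) t by simp
        qed
        moreover have "s < b"
        proof (rule ccontr)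
          assume "\<not> s < b"
          then have "h b \<le> h s" using mono [of b s] s(1) ab01 by (cases "s = b") auto
          then show False using s(2) t by simp
        qed
        moreover have "poly (q x) u \<noteq> 0" if "a < u" "u < b" for u
          using ab(4) that ab01 root_Z [OF q False, of u] by auto
        ultimately have "sgn (poly (q x) t) = sgn (poly (q x) s)"
          using t by (intro poly_sgn_constant_on_interval [of a b]) auto
        then show ?thesis using hsgn [of q s] s q DE' by auto
      qed
      have ends: "sgn_match E x x' a (h a)" "sgn_match E x x' b (h b)"
        using h(3) ab01 E'(1) unfolding sgn_match_def by blast+
      have p'D: "p' \<in> D" by (simp add: D_def)
      show "order_match R a b (h a) (h b)"
        unfolding R_def
      proof (rule order_match_poly_gap)
        show "a < b" "h a < h b" using ab(3) ab01 mono by auto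
        show "pderiv (p x) = 0 \<longleftrightarrow> pderiv (p x') = 0"
          using q0 [OF p'D] by (simp add: p'_def)
        show "poly (pderiv (p x)) t \<noteq> 0" if "pderiv (p x) \<noteq> 0" "a < t" "t < b" for t
          using ab(4) that ab01 root_Z [OF p'D, of t] by (auto simp: p'_def)
        show "sgn (poly (pderiv (p x)) t) = sgn (poly (pderiv (p x')) t')"
          if "a < t" "t < b" "h a < t'" "t' < h b" for t t'
          using gap [OF p'D that] by (simp add: p'_def)
        show "sgn_match E x x' t t'" if "a < t" "t < b" "h a < t'" "t' < h b" for t t'
          using gap that by (simp add: sgn_match_def D_def)
      qed (use Zsgn ab ends in auto)
    next
      fix a b c assume "a < c" "c < b" "order_match R a c (h a) (h c)" "order_match R c b (h c) (h b)"
      then show "order_match R a b (h a) (h b)" using order_match_glue less_imp_le by blast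
    qed (use finZ in \<open>auto simp: Z_def\<close>)
    moreover have "R = sgn_match (insert p E) x x'"
      by (auto simp: R_def sgn_match_def fun_eq_iff)
    ultimately show ?thesis by (simp add: h01)
  qed
  ultimately show ?thesis
    unfolding sgn_determined_def by (intro exI [of _ "\<A> \<union> \<B> \<union> \<C>"] conjI allI impI)
qed

text \<open>The outer induction is on the number of coefficients, the inner one on the number of
  members with the full number of them. Removing such a member \<open>p\<close> adds only its
  derivative and its pseudo-remainders by degrees \<open>k < Suc n\<close>, all of which have at
  most \<open>n\<close> coefficients.\<close>

lemma sgn_determined_poly_family:
  assumes "finite F" and "\<And>p. p \<in> F \<Longrightarrow> poly_family n p"
  shows "sgn_determined F"
  using assms
proof (induction n arbitrary: F)
  case 0
  have "sgn_match F x x' t t'" for x x' t t'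
    unfolding sgn_match_def
  proof
    fix p assume "p \<in> F"
    then have "p x = 0" "p x' = 0" using 0(2) poly_family_0 by blast+
    then show "sgn (poly (p x) t) = sgn (poly (p x') t')" by simp
  qed
  then have "order_match (sgn_match F x x') 0 1 0 1" for x x'
    by (intro order_match_linear) auto
  then show ?case unfolding sgn_determined_def by (intro exI [of _ "{}"]) simp
next
  case (Suc n)
  have "sgn_determined (D \<union> G)"
    if "finite D" "\<And>p. p \<in> D \<Longrightarrow> poly_family (Suc n) p" "finite G" "\<And>p. p \<in> G \<Longrightarrow> poly_family n p"
    for D G :: "('a \<Rightarrow> real poly) set"
    using that
  proof (induction D arbitrary: G rule: finite_induct)
    case empty
    then show ?case using Suc.IH by simp
  next
    case (insert p D)
    define p' where "p' = (\<lambda>x. pderiv (p x))"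
    have p: "poly_family (Suc n) p" using insert.prems by simp
    define E where "E = D \<union> G"
    have E: "poly_family (Suc n) q" if "q \<in> insert p' E" for q
      using that insert.prems(1,3) poly_family_mono [of n _ "Suc n"] poly_family_pderiv [OF p]
      unfolding E_def p'_def by auto
    have "\<exists>r. poly_family k r \<and> (\<forall>x t. q x \<noteq> 0 \<longrightarrow> degree (q x) = k \<longrightarrow> poly (q x) t = 0 \<longrightarrow>
           sgn (poly (r x) t) = sgn (poly (p x) t))" if "q \<in> insert p' E" for q k
      using poly_family_pseudo_rem [OF p E [OF that]] by metis
    then obtain rem where rem: "\<And>q k. q \<in> insert p' E \<Longrightarrow> poly_family k (rem q k)"
      "\<And>q k x t. q \<in> insert p' E \<Longrightarrow> q x \<noteq> 0 \<Longrightarrow> degree (q x) = k \<Longrightarrow> poly (q x) t = 0 \<Longrightarrow>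
           sgn (poly (rem q k x) t) = sgn (poly (p x) t)"
      by metis
    define G' where "G' = insert p' (G \<union> (\<lambda>(q, k). rem q k) ` (insert p' E \<times> {..<Suc n}))"
    have "sgn_determined (D \<union> G')"
    proof (rule insert.IH)
      show "finite G'" using insert by (simp add: G'_def E_def)
      show "poly_family n q" if "q \<in> G'" for q
      proof -
        have "poly_family n (rem q k)" if "q \<in> insert p' E" "k < Suc n" for q k
          using rem(1) [OF that(1), of k] that(2) poly_family_mono by fastforce
        then show ?thesis
          using that insert.prems(3) poly_family_pderiv [OF p] unfolding G'_def p'_def by auto
      qed
    qed (use insert.prems in auto)
    then have "sgn_determined (insert p E)"
    proof (rule sgn_determined_insert [where n = "Suc n"])
      show "E \<subseteq> D \<union> G'" "(\<lambda>x. pderiv (p x)) \<in> D \<union> G'" by (auto simp: E_def G'_def p'_def)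
      show "finite E" using insert by (simp add: E_def)
      show "\<exists>r\<in>D \<union> G'. \<forall>x t. q x \<noteq> 0 \<longrightarrow> degree (q x) = k \<longrightarrow> poly (q x) t = 0 \<longrightarrow>
          sgn (poly (r x) t) = sgn (poly (p x) t)"
        if "q \<in> insert (\<lambda>x. pderiv (p x)) E" "k < Suc n" for q k
      proof (rule bexI [of _ "rem q k"])
        have q: "q \<in> insert p' E" using that(1) by (simp add: p'_def)
        show "\<forall>x t. q x \<noteq> 0 \<longrightarrow> degree (q x) = k \<longrightarrow> poly (q x) t = 0 \<longrightarrow>
          sgn (poly (rem q k x) t) = sgn (poly (p x) t)"
          using rem(2) [OF q] by blast
        show "rem q k \<in> D \<union> G'" using q that(2) unfolding G'_def by blast
      qed
    qed (use p E in auto)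
    then show ?case by (simp add: E_def)
  qed
  from this [of F "{}"] show ?case using Suc.prems by simp
qed

section \<open>The Tarski--Seidenberg theorem\<close>

lemma real_polynomial_function_prod_poly:
  fixes f :: "'a::euclidean_space \<times> real \<Rightarrow> real"
  assumes "real_polynomial_function f"
  obtains n p where "poly_family n p" and "\<And>x t. f (x, t) = poly (p x) t"
proof -
  have "\<exists>n p. poly_family n p \<and> (\<forall>x t. f (x, t) = poly (p x) t)"
    using assms
  proof induction
    case lin: (linear f)
    interpret bounded_linear f by (rule lin)
    have "bounded_linear (\<lambda>x. f (x, 0))"
      by (intro bounded_linear_compose [OF lin] bounded_linear_Pair bounded_linear_ident bounded_linear_zero)
    then have rp: "real_polynomial_function (\<lambda>x. f (x, 0))"
      by (rule real_polynomial_function.intros(1))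
    have rp2: "real_polynomial_function (\<lambda>x. coeff [:f (x, 0), f (0, 1):] i)" for i
    proof (cases i)
      case 0
      then show ?thesis using rp by simp
    next
      case (Suc j)
      then show ?thesis using real_polynomial_function.intros(2) by simp
    qed
    have "poly_family 2 (\<lambda>x. [:f (x, 0), f (0, 1):])"
      unfolding poly_family_def using rp2 by (auto simp: coeff_pCons split: nat.splits)
    moreover have "f (x, t) = poly [:f (x, 0), f (0, 1):] t" for x t
    proof -
      have "(x, t) = (x, 0) + t *\<^sub>R (0, 1)" by simp
      then have "f (x, t) = f (x, 0) + t *\<^sub>R f (0, 1)" by (metis add scale)
      then show ?thesis by simp
    qed
    ultimately show ?case by (intro exI [of _ 2] exI [of _ "\<lambda>x. [:f (x, 0), f (0, 1):]"]) blast
  next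
    case (const c)
    have "real_polynomial_function (\<lambda>x. coeff [:c:] i)" for i
      by (rule real_polynomial_function.intros(2))
    then have "poly_family 1 (\<lambda>x. [:c:])"
      by (auto simp: poly_family_def coeff_pCons split: nat.splits)
    then show ?case by (intro exI [of _ 1] exI [of _ "\<lambda>x. [:c:]"]) simp
  next
    case (add f g)
    then obtain n p m q where p: "poly_family n p" "\<And>x t. f (x, t) = poly (p x) t"
      and q: "poly_family m q" "\<And>x t. g (x, t) = poly (q x) t" by blast
    have "poly_family (max n m) (\<lambda>x. p x + q x)"
      using p(1) q(1) by (auto simp: poly_family_def intro!: real_polynomial_function.intros(3))
    then show ?case using p(2) q(2)
      by (intro exI [of _ "max n m"] exI [of _ "\<lambda>x. p x + q x"]) simp
  next
    case (mult f g)
    then obtain n p m q where p: "poly_family n p" "\<And>x t. f (x, t) = poly (p x) t"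
      and q: "poly_family m q" "\<And>x t. g (x, t) = poly (q x) t" by blast
    have "real_polynomial_function (\<lambda>x. coeff (p x * q x) i)" for i
      unfolding coeff_mult using p(1) q(1)
      by (intro real_polynomial_function_sum real_polynomial_function.intros(4))
        (auto simp: poly_family_def)
    moreover have "coeff (p x * q x) i = 0" if "i \<ge> n + m" for x i
      unfolding coeff_mult
    proof (rule sum.neutral, rule ballI)
      fix j assume "j \<in> {..i}"
      have "n \<le> j \<or> m \<le> i - j" using that by linarith
      then show "coeff (p x) j * coeff (q x) (i - j) = 0"
        using p(1) q(1) by (auto simp: poly_family_def)
    qed
    ultimately have "poly_family (n + m) (\<lambda>x. p x * q x)"
      by (simp add: poly_family_def)
    then show ?case using p(2) q(2)
      by (intro exI [of _ "n + m"] exI [of _ "\<lambda>x. p x * q x"]) simp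
  qed
  then show ?thesis using that by blast
qed

text \<open>Dependence on signs alone passes through the generation of \<open>S\<close>: complements
  keep the family \<open>F\<close>, and unions join two families.\<close>

lemma semialgebraic_sgn_determined:
  fixes S :: "('a::euclidean_space \<times> real) set"
  assumes "semialgebraic S"
  obtains n F where "finite F" and "\<And>p. p \<in> F \<Longrightarrow> poly_family n p"
    and "\<And>x t x' t'. sgn_match F x x' t t' \<Longrightarrow> (x, t) \<in> S \<longleftrightarrow> (x', t') \<in> S"
proof -
  have "\<exists>n F. finite F \<and> (\<forall>p\<in>F. poly_family n p) \<and>
      (\<forall>x t x' t'. sgn_match F x x' t t' \<longrightarrow> ((x, t) \<in> S \<longleftrightarrow> (x', t') \<in> S))"
    using assms
  proof induction
    case (positive f)
    then obtain n p where p: "poly_family n p" "\<And>x t. f (x, t) = poly (p x) t"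
      using real_polynomial_function_prod_poly by metis
    have "(x, t) \<in> {x. 0 < f x} \<longleftrightarrow> (x', t') \<in> {x. 0 < f x}" if "sgn_match {p} x x' t t'" for x t x' t'
    proof -
      have "sgn (poly (p x) t) = sgn (poly (p x') t')" using that by (simp add: sgn_match_def)
      then have "0 < poly (p x) t \<longleftrightarrow> 0 < poly (p x') t'" using sgn_greater by metis
      then show ?thesis by (simp add: p(2))
    qed
    then show ?case
      using p(1) by (intro exI [of _ n] exI [of _ "{p}"]) blast
  next
    case (complement S)
    then show ?case by simp
  next
    case (union S T)
    then obtain n F m G where F: "finite F" "\<forall>p\<in>F. poly_family n p"
      "\<And>x t x' t'. sgn_match F x x' t t' \<Longrightarrow> ((x, t) \<in> S \<longleftrightarrow> (x', t') \<in> S)"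
      and G: "finite G" "\<forall>p\<in>G. poly_family m p"
      "\<And>x t x' t'. sgn_match G x x' t t' \<Longrightarrow> ((x, t) \<in> T \<longleftrightarrow> (x', t') \<in> T)" by blast
    have "\<forall>p\<in>F \<union> G. poly_family (max n m) p"
      using F(2) G(2) poly_family_mono max.cobounded1 max.cobounded2 by blast
    moreover have "((x, t) \<in> S \<union> T \<longleftrightarrow> (x', t') \<in> S \<union> T)" if "sgn_match (F \<union> G) x x' t t'" for x t x' t'
    proof -
      have "sgn_match F x x' t t'" "sgn_match G x x' t t'" using that by (auto simp: sgn_match_def)
      then show ?thesis using F(3) G(3) by blast
    qed
    ultimately show ?case
      using F(1) G(1) by (intro exI [of _ "max n m"] exI [of _ "F \<union> G"]) blast
  qed
  then show ?thesis using that by blast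
qed

text \<open>The matching carries a witness over one parameter to a witness over any other parameter
  with the same membership pattern.\<close>

lemma semialgebraic_ex_unit_interval:
  fixes S :: "('a::euclidean_space \<times> real) set"
  assumes "semialgebraic S"
  shows "semialgebraic {x. \<exists>t\<in>{0..1}. (x, t) \<in> S}"
proof -
  obtain n F where F: "finite F" "\<And>p. p \<in> F \<Longrightarrow> poly_family n p"
    "\<And>x t x' t'. sgn_match F x x' t t' \<Longrightarrow> (x, t) \<in> S \<longleftrightarrow> (x', t') \<in> S"
    using semialgebraic_sgn_determined [OF assms] by metis
  obtain \<A> where \<A>: "finite \<A>" "\<forall>A\<in>\<A>. semialgebraic A"
    "\<And>x x'. (\<forall>A\<in>\<A>. x \<in> A \<longleftrightarrow> x' \<in> A) \<Longrightarrow> order_match (sgn_match F x x') 0 1 0 1"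
    using sgn_determined_poly_family [OF F(1,2)] unfolding sgn_determined_def by blast
  show ?thesis
  proof (rule semialgebraic_atoms [OF \<A>(1)])
    fix x x' assume "\<And>A. A \<in> \<A> \<Longrightarrow> x \<in> A \<longleftrightarrow> x' \<in> A" and "\<exists>t\<in>{0..1}. (x, t) \<in> S"
    then obtain h t where "h ` {0..1} = {0..1}" "\<forall>t\<in>{0..1}. sgn_match F x x' t (h t)"
      "t \<in> {0..1}" "(x, t) \<in> S"
      using \<A>(3) [of x x'] unfolding order_match_def by blast
    then have "h t \<in> {0..1}" "(x', h t) \<in> S"
      using F(3) by blast+
    then show "\<exists>t\<in>{0..1}. (x', t) \<in> S" by blast
  qed (use \<A>(2) in blast)
qed

text \<open>Multiplying a polynomial in \<open>inverse u\<close> by a power of the positive number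
  \<open>u\<close> clears the denominators and preserves the sign.\<close>

lemma semialgebraic_inverse_snd:
  fixes S :: "('a::euclidean_space \<times> real) set"
  assumes "semialgebraic S"
  shows "semialgebraic {(x, u). 0 < u \<and> (x, inverse u) \<in> S}"
proof -
  have pos: "semialgebraic {z::'a \<times> real. 0 < snd z}"
    by (intro semialgebraic_gt real_polynomial_function.intros(1) bounded_linear_snd)
  have "semialgebraic {z::'a \<times> real. 0 < snd z \<and> (fst z, inverse (snd z)) \<in> S}"
    using assms
  proof induction
    case (positive f)
    then obtain n p where p: "poly_family n p" "\<And>x t. f (x, t) = poly (p x) t"
      using real_polynomial_function_prod_poly by metis
    \<comment> \<open>The polynomial with reversed coefficients,
      \<open>u ^ n * poly (p x) (inverse u)\<close> for positive \<open>u\<close>.\<close>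
    define g where "g z = (\<Sum>i<n. coeff (p (fst z)) i * snd z ^ (n - i))" for z :: "'a \<times> real"
    have rp: "real_polynomial_function (\<lambda>z::'a \<times> real. coeff (p (fst z)) i)" for i
    proof -
      have "real_polynomial_function (\<lambda>x. coeff (p x) i)" using p(1) by (simp add: poly_family_def)
      then have "real_polynomial_function ((\<lambda>x. coeff (p x) i) \<circ> (fst :: 'a \<times> real \<Rightarrow> 'a))"
        by (intro real_polynomial_function_compose polynomial_function_bounded_linear bounded_linear_fst)
      then show ?thesis by (simp add: o_def)
    qed
    have "real_polynomial_function g"
      unfolding g_def
      by (intro real_polynomial_function_sum real_polynomial_function.intros(4) rp
          real_polynomial_function_power real_polynomial_function.intros(1) bounded_linear_snd) simp
    then have "semialgebraic {z. 0 < snd z \<and> 0 < g z}"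
      by (intro semialgebraic_conj pos semialgebraic_gt)
    moreover have "0 < g z \<longleftrightarrow> 0 < f (fst z, inverse (snd z))" if "0 < snd z" for z
    proof -
      have "snd z ^ (n - i) = snd z ^ n * inverse (snd z) ^ i" if "i < n" for i
        using \<open>0 < snd z\<close> that by (simp add: power_diff power_inverse field_simps)
      then have "g z = snd z ^ n * f (fst z, inverse (snd z))"
        unfolding g_def p(2) poly_family_eval [OF p(1)] sum_distrib_left
        by (intro sum.cong) auto
      then show ?thesis using that by (simp add: zero_less_mult_iff)
    qed
    ultimately show ?case by (simp cong: conj_cong)
  next
    case (complement S)
    have "semialgebraic {z::'a \<times> real. 0 < snd z \<and> \<not> (0 < snd z \<and> (fst z, inverse (snd z)) \<in> S)}"
      by (intro semialgebraic_conj semialgebraic_not complement.IH pos)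
    then show ?case by (simp cong: conj_cong)
  next
    case (union S T)
    then show ?case
      using semialgebraic_disj [OF union.IH] by (simp add: conj_disj_distribL)
  qed
  then show ?thesis by (simp add: case_prod_unfold)
qed

text \<open>The line is covered by \<open>[0, 1]\<close>, the inverses of \<open>(0, 1]\<close> and
  the mirror images of both, so a projection along the line is a union of projections along
  \<open>[0, 1]\<close>.\<close>

lemma semialgebraic_ex_real:
  fixes S :: "('a::euclidean_space \<times> real) set"
  assumes "semialgebraic S"
  shows "semialgebraic {x. \<exists>t. (x, t) \<in> S}"
proof -
  have bl: "bounded_linear (\<lambda>(x, t). (x, - t) :: 'a \<times> real)"
    unfolding case_prod_beta
    by (intro bounded_linear_Pair bounded_linear_fst bounded_linear_minus bounded_linear_snd)
  define T where "T = {z. (\<lambda>(x, t). (x, - t)) z \<in> S}"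
  have T: "semialgebraic T"
    unfolding T_def by (intro semialgebraic_vimage_linear bl assms)
  have ST: "semialgebraic (S \<union> T)" by (intro semialgebraic.union assms T)
  have "semialgebraic {x. (\<exists>t\<in>{0..1}. (x, t) \<in> S \<union> T) \<or>
      (\<exists>u\<in>{0..1}. (x, u) \<in> {(x, u). 0 < u \<and> (x, inverse u) \<in> S \<union> T})}"
    by (intro semialgebraic_disj semialgebraic_ex_unit_interval ST semialgebraic_inverse_snd)
  moreover have "(\<exists>t\<in>{0..1}. (x, t) \<in> S \<union> T) \<or>
      (\<exists>u\<in>{0..1}. (x, u) \<in> {(x, u). 0 < u \<and> (x, inverse u) \<in> S \<union> T}) \<longleftrightarrow> (\<exists>t. (x, t) \<in> S)"
    (is "?L \<longleftrightarrow> ?R") for x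
  proof
    assume ?L
    then show ?R by (auto simp: T_def)
  next
    assume ?R
    then obtain t where t: "(x, t) \<in> S" by blast
    then have "(x, \<bar>t\<bar>) \<in> S \<union> T" by (auto simp: T_def abs_if)
    then show ?L
    proof (cases "\<bar>t\<bar> \<le> 1")
      case True
      then show ?thesis using \<open>(x, \<bar>t\<bar>) \<in> _\<close> by (intro disjI1 bexI [of _ "\<bar>t\<bar>"]) auto
    next
      case False
      then have "inverse \<bar>t\<bar> \<in> {0..1}" "0 < inverse \<bar>t\<bar>"
        by (auto simp: inverse_le_1_iff)
      then show ?thesis
        using \<open>(x, \<bar>t\<bar>) \<in> _\<close> by (intro disjI2 bexI [of _ "inverse \<bar>t\<bar>"]) auto
    qed
  qed
  ultimately show ?thesis by simp
qed

lemma semialgebraic_ex: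
  fixes S :: "('a::euclidean_space \<times> 'b::euclidean_space) set"
  assumes "semialgebraic S"
  shows "semialgebraic {x. \<exists>y. (x, y) \<in> S}"
proof -
  \<comment> \<open>Quantifying over displacements along \<open>B\<close> keeps the type of the
    space, so an induction over subsets of \<open>Basis\<close> replaces one over the dimension. The
    projection is read off at second component 0.\<close>
  define T where "T B = {z. \<exists>c. (fst z, snd z + (\<Sum>b\<in>B. c b *\<^sub>R b)) \<in> S}" for B
  have "semialgebraic (T B)" if "finite B" for B
    using that
  proof (induction rule: finite_induct)
    case empty
    then show ?case using assms by (simp add: T_def)
  next
    case (insert b B)
    have bl: "bounded_linear (\<lambda>(z, t). (fst z, snd z + t *\<^sub>R b) :: 'a \<times> 'b)"
      unfolding case_prod_beta
      by (intro bounded_linear_intros)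
    have "semialgebraic {z. \<exists>t. (z, t) \<in> {w. (\<lambda>(z, t). (fst z, snd z + t *\<^sub>R b)) w \<in> T B}}"
      by (intro semialgebraic_ex_real semialgebraic_vimage_linear bl insert.IH)
    moreover have "(\<exists>t. (fst z, snd z + t *\<^sub>R b) \<in> T B) \<longleftrightarrow> z \<in> T (insert b B)" for z
    proof
      assume "\<exists>t. (fst z, snd z + t *\<^sub>R b) \<in> T B"
      then obtain t c where "(fst z, snd z + t *\<^sub>R b + (\<Sum>b\<in>B. c b *\<^sub>R b)) \<in> S"
        by (auto simp: T_def)
      moreover have "(\<Sum>d\<in>insert b B. (c(b := t)) d *\<^sub>R d) = t *\<^sub>R b + (\<Sum>b\<in>B. c b *\<^sub>R b)"
        using insert by (auto intro!: arg_cong2 [where f = "(+)"] sum.cong)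
      ultimately show "z \<in> T (insert b B)"
        unfolding T_def mem_Collect_eq by (intro exI [of _ "c(b := t)"]) (simp only: add.assoc)
    next
      assume "z \<in> T (insert b B)"
      then obtain c where "(fst z, snd z + c b *\<^sub>R b + (\<Sum>b\<in>B. c b *\<^sub>R b)) \<in> S"
        using insert by (auto simp: T_def add.assoc)
      then show "\<exists>t. (fst z, snd z + t *\<^sub>R b) \<in> T B" by (auto simp: T_def)
    qed
    ultimately show ?case by simp
  qed
  then have "semialgebraic {x. (x, 0) \<in> T Basis}"
    by (intro semialgebraic_vimage_linear bounded_linear_Pair bounded_linear_ident bounded_linear_zero) simp
  moreover have "(x, 0) \<in> T Basis \<longleftrightarrow> (\<exists>y. (x, y) \<in> S)" for x
  proof
    show "(x, 0) \<in> T Basis \<Longrightarrow> \<exists>y. (x, y) \<in> S" by (auto simp: T_def)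
  next
    assume "\<exists>y. (x, y) \<in> S"
    then obtain y where "(x, \<Sum>b\<in>Basis. (y \<bullet> b) *\<^sub>R b) \<in> S" by (auto simp: euclidean_representation)
    then show "(x, 0) \<in> T Basis" unfolding T_def by (auto intro!: exI [of _ "\<lambda>b. y \<bullet> b"])
  qed
  ultimately show ?thesis by simp
qed

section \<open>Semialgebraic functions\<close>

text \<open>Totality frees the closure rules from domain conditions; functions of interest on a
  subset only are given a default value elsewhere.\<close>

abbreviation semialgebraic_fun :: "('a::euclidean_space \<Rightarrow> 'b::euclidean_space) \<Rightarrow> bool" where
  "semialgebraic_fun \<equiv> semialgebraic_on UNIV"

lemma semialgebraic_on_iff:
  "semialgebraic_on S f \<longleftrightarrow> semialgebraic {z. fst z \<in> S \<and> snd z = f (fst z)}"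
proof -
  have "{(x, f x) | x. x \<in> S} = {z. fst z \<in> S \<and> snd z = f (fst z)}" by auto
  then show ?thesis by (simp add: semialgebraic_on_def)
qed

lemma semialgebraic_fun_iff: "semialgebraic_fun f \<longleftrightarrow> semialgebraic {z. snd z = f (fst z)}"
  by (simp add: semialgebraic_on_iff)

lemma semialgebraic_Ex [semialgebraic_intros]:
  assumes "semialgebraic {z. P (fst z) (snd z)}"
  shows "semialgebraic {x. \<exists>y. P x y}"
  using semialgebraic_ex [OF assms] by simp

lemma semialgebraic_All [semialgebraic_intros]:
  assumes "semialgebraic {z. P (fst z) (snd z)}"
  shows "semialgebraic {x. \<forall>y. P x y}"
proof -
  have "semialgebraic {x. \<not> (\<exists>y. \<not> P x y)}"
    by (intro semialgebraic_not semialgebraic_Ex assms)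
  then show ?thesis by simp
qed

lemma semialgebraic_vimage_fst: "semialgebraic {x. P x} \<Longrightarrow> semialgebraic {z. P (fst z)}"
  using semialgebraic_vimage_linear [OF bounded_linear_fst] by fastforce

text \<open>For a function given by its graph a preimage is itself a projection, so this already
  rests on Tarski-Seidenberg.\<close>

lemma semialgebraic_mem [semialgebraic_intros]:
  assumes "semialgebraic S" and f: "semialgebraic_fun f"
  shows "semialgebraic {x. f x \<in> S}"
proof -
  have "semialgebraic {z. snd z \<in> S}"
    by (rule semialgebraic_vimage_linear [OF bounded_linear_snd assms(1)])
  then have "semialgebraic {x. \<exists>y. y = f x \<and> y \<in> S}"
    by (intro semialgebraic_Ex semialgebraic_conj f [unfolded semialgebraic_fun_iff])
  then show ?thesis by simp
qed

lemma semialgebraic_Bex [semialgebraic_intros]: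
  assumes "semialgebraic S" and "semialgebraic {z. P (fst z) (snd z)}"
  shows "semialgebraic {x. \<exists>y\<in>S. P x y}"
  unfolding Bex_def
  by (intro semialgebraic_Ex semialgebraic_conj assms semialgebraic_vimage_linear [OF bounded_linear_snd])

lemma semialgebraic_Ball [semialgebraic_intros]:
  assumes "semialgebraic S" and "semialgebraic {z. P (fst z) (snd z)}"
  shows "semialgebraic {x. \<forall>y\<in>S. P x y}"
  unfolding Ball_def
  by (intro semialgebraic_All semialgebraic_imp assms semialgebraic_vimage_linear [OF bounded_linear_snd])

lemma semialgebraic_fun_polynomial:
  fixes f :: "'a::euclidean_space \<Rightarrow> 'b::euclidean_space"
  assumes "polynomial_function f"
  shows "semialgebraic_fun f"
proof -
  have pf: "polynomial_function (\<lambda>z::'a \<times> 'b. snd z - f (fst z))"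
    using polynomial_function_compose [OF polynomial_function_bounded_linear [OF bounded_linear_fst] assms]
      polynomial_function_bounded_linear [OF bounded_linear_snd]
    by (intro polynomial_function_diff) (auto simp: o_def)
  have "semialgebraic {z. \<forall>b\<in>Basis. (snd z - f (fst z)) \<bullet> b = 0}"
    using pf unfolding polynomial_function_iff_Basis_inner
    by (intro semialgebraic_Ball_finite semialgebraic_eq0) auto
  then show ?thesis
    by (simp add: semialgebraic_fun_iff euclidean_all_zero_iff)
qed

lemma semialgebraic_fun_linear: "bounded_linear f \<Longrightarrow> semialgebraic_fun f"
  by (intro semialgebraic_fun_polynomial polynomial_function_bounded_linear)

lemma semialgebraic_fun_const [semialgebraic_intros]: "semialgebraic_fun (\<lambda>x. c)"
  by (intro semialgebraic_fun_polynomial polynomial_function_const)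

lemma semialgebraic_fun_ident [semialgebraic_intros]: "semialgebraic_fun (\<lambda>x. x)"
  by (intro semialgebraic_fun_polynomial polynomial_function_id)

lemma semialgebraic_fun_fst' [semialgebraic_intros]: "semialgebraic_fun fst"
  by (intro semialgebraic_fun_linear bounded_linear_fst)

lemma semialgebraic_fun_snd' [semialgebraic_intros]: "semialgebraic_fun snd"
  by (intro semialgebraic_fun_linear bounded_linear_snd)

lemma semialgebraic_fun_compose:
  assumes f: "semialgebraic_fun f" and g: "semialgebraic_fun g"
  shows "semialgebraic_fun (\<lambda>x. g (f x))"
proof -
  have 1: "bounded_linear (\<lambda>z::('a \<times> 'c) \<times> 'b. (fst (fst z), snd z))"
    and 2: "bounded_linear (\<lambda>z::('a \<times> 'c) \<times> 'b. (snd z, snd (fst z)))"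
    by (intro bounded_linear_intros)+
  have "semialgebraic {z. \<exists>y. (fst z, y) \<in> {z. snd z = f (fst z)} \<and> (y, snd z) \<in> {z. snd z = g (fst z)}}"
    using f g unfolding semialgebraic_fun_iff
    by (intro semialgebraic_Ex semialgebraic_conj
        semialgebraic_vimage_linear [OF 1] semialgebraic_vimage_linear [OF 2])
  then show ?thesis by (simp add: semialgebraic_fun_iff)
qed

lemma semialgebraic_fun_fst [semialgebraic_intros]:
  "semialgebraic_fun f \<Longrightarrow> semialgebraic_fun (\<lambda>x. fst (f x))"
  by (rule semialgebraic_fun_compose [OF _ semialgebraic_fun_fst'])

lemma semialgebraic_fun_snd [semialgebraic_intros]:
  "semialgebraic_fun f \<Longrightarrow> semialgebraic_fun (\<lambda>x. snd (f x))"
  by (rule semialgebraic_fun_compose [OF _ semialgebraic_fun_snd'])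

lemma semialgebraic_fun_Pair [semialgebraic_intros]:
  assumes f: "semialgebraic_fun f" and g: "semialgebraic_fun g"
  shows "semialgebraic_fun (\<lambda>x. (f x, g x))"
proof -
  have 1: "bounded_linear (\<lambda>z::'a \<times> 'b \<times> 'c. (fst z, fst (snd z)))"
    and 2: "bounded_linear (\<lambda>z::'a \<times> 'b \<times> 'c. (fst z, snd (snd z)))"
    by (intro bounded_linear_intros)+
  have "semialgebraic {z. (fst z, fst (snd z)) \<in> {z. snd z = f (fst z)} \<and>
      (fst z, snd (snd z)) \<in> {z. snd z = g (fst z)}}"
    using f g unfolding semialgebraic_fun_iff
    by (intro semialgebraic_conj semialgebraic_vimage_linear [OF 1] semialgebraic_vimage_linear [OF 2])
  then show ?thesis by (simp add: semialgebraic_fun_iff prod_eq_iff)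
qed

lemma semialgebraic_fun_compose2:
  assumes "semialgebraic_fun (\<lambda>z. h (fst z) (snd z))"
    and "semialgebraic_fun f" and "semialgebraic_fun g"
  shows "semialgebraic_fun (\<lambda>x. h (f x) (g x))"
  using semialgebraic_fun_compose [OF semialgebraic_fun_Pair [OF assms(2,3)] assms(1)] by simp

lemma semialgebraic_fun_add [semialgebraic_intros]:
  "semialgebraic_fun f \<Longrightarrow> semialgebraic_fun g \<Longrightarrow> semialgebraic_fun (\<lambda>x. f x + g x)"
  by (rule semialgebraic_fun_compose2 [where h = "(+)"])
    (intro semialgebraic_fun_linear bounded_linear_add bounded_linear_fst bounded_linear_snd)

lemma semialgebraic_fun_diff [semialgebraic_intros]:
  "semialgebraic_fun f \<Longrightarrow> semialgebraic_fun g \<Longrightarrow> semialgebraic_fun (\<lambda>x. f x - g x)"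
  by (rule semialgebraic_fun_compose2 [where h = "(-)"])
    (intro semialgebraic_fun_linear bounded_linear_sub bounded_linear_fst bounded_linear_snd)

lemma semialgebraic_fun_scaleR [semialgebraic_intros]:
  "semialgebraic_fun f \<Longrightarrow> semialgebraic_fun g \<Longrightarrow> semialgebraic_fun (\<lambda>x. f x *\<^sub>R g x)"
  by (rule semialgebraic_fun_compose2 [where h = "(*\<^sub>R)"])
    (intro semialgebraic_fun_polynomial polynomial_function_mult polynomial_function_bounded_linear
      bounded_linear_fst bounded_linear_snd)

lemma semialgebraic_fun_mult [semialgebraic_intros]:
  fixes f g :: "'a::euclidean_space \<Rightarrow> real"
  shows "semialgebraic_fun f \<Longrightarrow> semialgebraic_fun g \<Longrightarrow> semialgebraic_fun (\<lambda>x. f x * g x)"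
  using semialgebraic_fun_scaleR [of f g] by simp

lemma semialgebraic_fun_inner [semialgebraic_intros]:
  "semialgebraic_fun f \<Longrightarrow> semialgebraic_fun g \<Longrightarrow> semialgebraic_fun (\<lambda>x. f x \<bullet> g x)"
proof (rule semialgebraic_fun_compose2 [where h = "(\<bullet>)"])
  have "real_polynomial_function (\<lambda>z::'b \<times> 'b. \<Sum>b\<in>Basis. (fst z \<bullet> b) * (snd z \<bullet> b))"
    by (intro real_polynomial_function_sum real_polynomial_function.intros(4)
        real_polynomial_function.intros(1) bounded_linear_inner_left_comp
        bounded_linear_fst bounded_linear_snd finite_Basis)
  then show "semialgebraic_fun (\<lambda>z::'b \<times> 'b. fst z \<bullet> snd z)"
    by (intro semialgebraic_fun_polynomial)
      (simp add: euclidean_inner [symmetric] real_polynomial_function_eq)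
qed

lemma semialgebraic_fun_sum [semialgebraic_intros]:
  assumes "finite I" and "\<And>i. i \<in> I \<Longrightarrow> semialgebraic_fun (f i)"
  shows "semialgebraic_fun (\<lambda>x. \<Sum>i\<in>I. f i x)"
  using assms by (induction rule: finite_induct) (simp_all add: semialgebraic_intros)

lemma semialgebraic_fun_vec_nth [semialgebraic_intros]:
  fixes f :: "'a::euclidean_space \<Rightarrow> 'b::euclidean_space ^ 'n"
  shows "semialgebraic_fun f \<Longrightarrow> semialgebraic_fun (\<lambda>x. f x $ i)"
  by (rule semialgebraic_fun_compose [OF _ semialgebraic_fun_linear [OF bounded_linear_vec_nth]])

lemma semialgebraic_eq [semialgebraic_intros]:
  assumes "semialgebraic_fun f" and "semialgebraic_fun g"
  shows "semialgebraic {x. f x = g x}"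
proof -
  have "semialgebraic {x. f x - g x \<in> {v. \<forall>b\<in>Basis. v \<bullet> b = 0}}"
    by (intro semialgebraic_mem semialgebraic_fun_diff assms semialgebraic_Ball_finite finite_Basis
        semialgebraic_eq0 real_polynomial_function.intros(1) bounded_linear_inner_left)
  then show ?thesis by (simp add: euclidean_all_zero_iff)
qed

lemma semialgebraic_less [semialgebraic_intros]:
  fixes f g :: "'a::euclidean_space \<Rightarrow> real"
  assumes "semialgebraic_fun f" and "semialgebraic_fun g"
  shows "semialgebraic {x. f x < g x}"
proof -
  have "semialgebraic {x. g x - f x \<in> {t. 0 < t}}"
    by (intro semialgebraic_mem semialgebraic_fun_diff assms
        semialgebraic_gt real_polynomial_function.intros(1) bounded_linear_ident)
  then show ?thesis by simp
qed

lemma semialgebraic_le [semialgebraic_intros]: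
  fixes f g :: "'a::euclidean_space \<Rightarrow> real"
  assumes "semialgebraic_fun f" and "semialgebraic_fun g"
  shows "semialgebraic {x. f x \<le> g x}"
  using semialgebraic_not [OF semialgebraic_less [OF assms(2,1)]] by (simp add: not_less)

lemma semialgebraic_fun_norm [semialgebraic_intros]:
  assumes "semialgebraic_fun f"
  shows "semialgebraic_fun (\<lambda>x. norm (f x))"
proof (rule semialgebraic_fun_compose [OF assms])
  have "semialgebraic {z::'b \<times> real. 0 \<le> snd z \<and> snd z * snd z = fst z \<bullet> fst z}"
    by (intro semialgebraic_intros)
  moreover have "0 \<le> snd z \<and> snd z * snd z = fst z \<bullet> fst z \<longleftrightarrow> snd z = norm (fst z)"
    for z :: "'b \<times> real"
    using power2_eq_imp_eq [of "snd z" "norm (fst z)"]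
    by (auto simp: power2_norm_eq_inner power2_eq_square norm_eq_sqrt_inner)
  ultimately show "semialgebraic_fun (norm :: 'b \<Rightarrow> real)"
    by (simp add: semialgebraic_fun_iff)
qed

lemma semialgebraic_fun_dist [semialgebraic_intros]:
  "semialgebraic_fun f \<Longrightarrow> semialgebraic_fun g \<Longrightarrow> semialgebraic_fun (\<lambda>x. dist (f x) (g x))"
  unfolding dist_norm by (intro semialgebraic_intros)

lemma semialgebraic_fun_If [semialgebraic_intros]:
  assumes "semialgebraic {x. P x}" and "semialgebraic_fun f" and "semialgebraic_fun g"
  shows "semialgebraic_fun (\<lambda>x. if P x then f x else g x)"
proof -
  have "semialgebraic {z. P (fst z) \<and> snd z = f (fst z) \<or> \<not> P (fst z) \<and> snd z = g (fst z)}"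
    using assms(2,3) unfolding semialgebraic_fun_iff
    by (intro semialgebraic_disj semialgebraic_conj semialgebraic_not
        semialgebraic_vimage_fst [OF assms(1)])
  moreover have "P (fst z) \<and> snd z = f (fst z) \<or> \<not> P (fst z) \<and> snd z = g (fst z) \<longleftrightarrow>
      snd z = (if P (fst z) then f (fst z) else g (fst z))" for z
    by auto
  ultimately show ?thesis by (simp add: semialgebraic_fun_iff)
qed

lemma semialgebraic_fun_divide [semialgebraic_intros]:
  fixes f g :: "'a::euclidean_space \<Rightarrow> real"
  assumes "semialgebraic_fun f" and "semialgebraic_fun g"
  shows "semialgebraic_fun (\<lambda>x. f x / g x)"
proof -
  \<comment> \<open>The first disjunct accounts for the convention
    \<open>inverse 0 = 0\<close>.\<close>
  have "semialgebraic {z::real \<times> real. fst z = 0 \<and> snd z = 0 \<or> fst z * snd z = 1}"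
    by (intro semialgebraic_intros)
  moreover have "fst z = 0 \<and> snd z = 0 \<or> fst z * snd z = 1 \<longleftrightarrow> snd z = inverse (fst z)"
    for z :: "real \<times> real"
    by (cases "fst z = 0") (auto simp: field_simps)
  ultimately have "semialgebraic_fun (inverse :: real \<Rightarrow> real)"
    by (simp add: semialgebraic_fun_iff)
  then have "semialgebraic_fun (\<lambda>x. inverse (g x))"
    by (rule semialgebraic_fun_compose [OF assms(2)])
  then show ?thesis
    unfolding divide_inverse by (intro semialgebraic_fun_mult assms)
qed

text \<open>Being the greatest lower bound is a first-order condition: a lower bound that is
  undercut after adding any positive \<open>e\<close>.\<close>

lemma semialgebraic_fun_INF:
  fixes h :: "'a::euclidean_space \<Rightarrow> 'b::euclidean_space \<Rightarrow> real"
  assumes E: "semialgebraic E" "E \<noteq> {}" and h: "semialgebraic_fun (\<lambda>z. h (fst z) (snd z))"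
    and bdd: "\<And>x. bdd_below (h x ` E)"
  shows "semialgebraic_fun (\<lambda>x. INF y\<in>E. h x y)"
proof -
  note h' [semialgebraic_intros] = semialgebraic_fun_compose2 [OF h]
  have "semialgebraic {z. (\<forall>y\<in>E. snd z \<le> h (fst z) y) \<and> (\<forall>e. 0 < e \<longrightarrow> (\<exists>y\<in>E. h (fst z) y < snd z + e))}"
    by (intro semialgebraic_intros E(1))
  moreover have "(\<forall>y\<in>E. t \<le> h x y) \<and> (\<forall>e. 0 < e \<longrightarrow> (\<exists>y\<in>E. h x y < t + e)) \<longleftrightarrow> t = (INF y\<in>E. h x y)"
    (is "?L \<longleftrightarrow> ?R") for x t
  proof
    assume L: ?L
    show ?R
    proof (rule antisym)
      show "t \<le> (INF y\<in>E. h x y)" using L E(2) by (intro cINF_greatest) auto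
      show "(INF y\<in>E. h x y) \<le> t"
      proof (rule field_le_epsilon)
        fix e :: real assume "0 < e"
        then obtain y where "y \<in> E" "h x y < t + e" using L by blast
        then show "(INF y\<in>E. h x y) \<le> t + e" using cINF_lower [OF bdd \<open>y \<in> E\<close>, of x] by simp
      qed
    qed
  next
    assume R: ?R
    have "\<exists>y\<in>E. h x y < t + e" if "0 < e" for e
      using cINF_less_iff [OF E(2) bdd, of x "t + e"] R that by simp
    then show ?L using R cINF_lower [OF bdd] by auto
  qed
  ultimately show ?thesis by (simp add: semialgebraic_fun_iff)
qed

lemma semialgebraic_fun_infdist [semialgebraic_intros]:
  assumes "semialgebraic E"
  shows "semialgebraic_fun (\<lambda>x. infdist x E)"
proof (cases "E = {}")
  case True
  then show ?thesis by (simp add: infdist_def semialgebraic_fun_const)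
next
  case False
  have "semialgebraic_fun (\<lambda>x. INF y\<in>E. dist x y)"
    by (intro semialgebraic_fun_INF assms False semialgebraic_intros bdd_belowI2 [of _ 0]) auto
  then show ?thesis using False by (simp add: infdist_def)
qed

section \<open>Lower limits of affine subspaces\<close>

text \<open>The Kuratowski lower limit along a filter. It serves both for punctured neighbourhoods
  and for sequences, and the existential form excludes every \<open>v\<close> when empty fibers
  occur frequently.\<close>

definition liminf_fiber :: "'a filter \<Rightarrow> ('a \<Rightarrow> 'b::metric_space set) \<Rightarrow> 'b set" where
  "liminf_fiber F H = {v. \<forall>e>0. eventually (\<lambda>y. \<exists>w\<in>H y. dist v w < e) F}"

lemma glaeser_refine_eq:
  fixes H :: "'a::metric_space \<Rightarrow> 'b::metric_space set"
  shows "glaeser_refine Q H x = H x \<inter> liminf_fiber (at x within Q) H"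
proof -
  have "((\<lambda>y. einfdist v (H y)) \<longlongrightarrow> 0) F \<longleftrightarrow> (\<forall>e>0. eventually (\<lambda>y. \<exists>w\<in>H y. dist v w < e) F)"
    (is "?L \<longleftrightarrow> ?R") for v and F :: "'a filter"
  proof
    assume L: ?L
    show ?R
    proof (intro allI impI)
      fix e :: real assume "0 < e"
      then have "eventually (\<lambda>y. einfdist v (H y) < ereal e) F"
        using order_tendstoD(2) [OF L, of "ereal e"] by simp
      then show "eventually (\<lambda>y. \<exists>w\<in>H y. dist v w < e) F"
        by (simp add: einfdist_def INF_less_iff)
    qed
  next
    assume R: ?R
    show ?L
    proof (rule order_tendstoI)
      fix a :: ereal assume "a < 0"
      have "0 \<le> einfdist v (H y)" for y
        unfolding einfdist_def by (intro INF_greatest) simp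
      then show "eventually (\<lambda>y. a < einfdist v (H y)) F"
        using \<open>a < 0\<close> less_le_trans by (intro always_eventually) blast
    next
      fix a :: ereal assume "0 < a"
      then obtain e where e: "0 < ereal e" "ereal e < a"
        using ereal_dense2 by blast
      then have "eventually (\<lambda>y. \<exists>w\<in>H y. dist v w < e) F" using R by simp
      then have "eventually (\<lambda>y. einfdist v (H y) < ereal e) F"
        by (simp add: einfdist_def INF_less_iff)
      then show "eventually (\<lambda>y. einfdist v (H y) < a) F"
        using e(2) by (auto elim!: eventually_mono)
    qed
  qed
  then show ?thesis by (auto simp: glaeser_refine_def liminf_fiber_def)
qed

lemma affine_liminf_fiber:
  fixes H :: "'a \<Rightarrow> 'b::real_normed_vector set"
  assumes "\<And>y. affine (H y)"
  shows "affine (liminf_fiber F H)"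
  unfolding affine_def
proof (intro ballI allI impI)
  fix p q and u v :: real assume pq: "p \<in> liminf_fiber F H" "q \<in> liminf_fiber F H" and uv: "u + v = 1"
  show "u *\<^sub>R p + v *\<^sub>R q \<in> liminf_fiber F H"
    unfolding liminf_fiber_def
  proof (intro CollectI allI impI)
    fix e :: real assume "0 < e"
    \<comment> \<open>The weights may be negative, so the tolerance is divided by the sum of their
      absolute values, which is positive because \<open>u + v = 1\<close>.\<close>
    define c where "c = \<bar>u\<bar> + \<bar>v\<bar>"
    define d where "d = e / c"
    have "0 < c" using uv unfolding c_def by linarith
    then have "0 < d" "c * d = e" using \<open>0 < e\<close> by (simp_all add: d_def)
    then have d: "0 < d" "\<bar>u\<bar> * d + \<bar>v\<bar> * d = e"
      by (simp_all add: c_def distrib_right)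
    have "eventually (\<lambda>y. \<exists>w\<in>H y. dist p w < d) F" "eventually (\<lambda>y. \<exists>w\<in>H y. dist q w < d) F"
      using pq d(1) by (auto simp: liminf_fiber_def)
    then show "eventually (\<lambda>y. \<exists>w\<in>H y. dist (u *\<^sub>R p + v *\<^sub>R q) w < e) F"
    proof eventually_elim
      case (elim y)
      then obtain a b where ab: "a \<in> H y" "dist p a < d" "b \<in> H y" "dist q b < d" by blast
      have "u *\<^sub>R a + v *\<^sub>R b \<in> H y"
        using assms [of y] ab uv by (simp add: affine_def)
      moreover have "dist (u *\<^sub>R p + v *\<^sub>R q) (u *\<^sub>R a + v *\<^sub>R b) < e"
      proof -
        have "dist (u *\<^sub>R p + v *\<^sub>R q) (u *\<^sub>R a + v *\<^sub>R b) = norm (u *\<^sub>R (p - a) + v *\<^sub>R (q - b))"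
          by (simp add: dist_norm algebra_simps)
        also have "\<dots> \<le> \<bar>u\<bar> * dist p a + \<bar>v\<bar> * dist q b"
          using norm_triangle_ineq [of "u *\<^sub>R (p - a)" "v *\<^sub>R (q - b)"] by (simp add: dist_norm)
        also have "\<dots> < \<bar>u\<bar> * d + \<bar>v\<bar> * d"
        proof (cases "u = 0")
          case True
          then show ?thesis using uv ab by simp
        next
          case False
          then have "\<bar>u\<bar> * dist p a < \<bar>u\<bar> * d" using ab by simp
          moreover have "\<bar>v\<bar> * dist q b \<le> \<bar>v\<bar> * d" using ab by (intro mult_left_mono) auto
          ultimately show ?thesis by simp
        qed
        finally show ?thesis using d(2) by simp
      qed
      ultimately show ?case by blast
    qed
  qed
qed

lemma affine_orthonormal_frame:
  fixes S :: "'b::euclidean_space set"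
  assumes "affine S" and "p \<in> S"
  obtains B where "finite B" "pairwise orthogonal B" "\<forall>b\<in>B. norm b = 1"
    "aff_dim S = int (card B)" "\<forall>b\<in>B. p + b \<in> S"
proof -
  have "subspace ((\<lambda>x. x - p) ` S)" using assms by (rule affine_diffs_subspace_subtract)
  then show ?thesis
  proof (rule orthonormal_basis_subspace)
    fix B assume B: "B \<subseteq> (\<lambda>x. x - p) ` S" "pairwise orthogonal B" "\<And>b. b \<in> B \<Longrightarrow> norm b = 1"
      "independent B" "card B = dim ((\<lambda>x. x - p) ` S)"
    have "p \<in> affine hull S" using assms(2) by (rule hull_inc)
    then have "aff_dim S = int (card B)" by (simp add: aff_dim_eq_dim_subtract B(5))
    moreover have "p + b \<in> S" if "b \<in> B" for b using B(1) that by auto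
    ultimately show ?thesis using that B independent_imp_finite by blast
  qed
qed

text \<open>Extend \<open>d\<close> linearly to \<open>f\<close>. If \<open>f v = 0\<close> for
  \<open>v\<close> in the span of \<open>B\<close>, then \<open>v\<close> is a combination of the
  errors \<open>d b - b\<close>. Orthonormality bounds the coefficients by \<open>norm v\<close>, so
  \<open>norm v\<close> is at most \<open>norm v * (card B * \<epsilon>)\<close>, which forces
  \<open>v = 0\<close>. Hence \<open>f\<close> is injective on the span.\<close>

lemma orthonormal_perturbation:
  fixes B :: "'b::euclidean_space set"
  assumes B: "finite B" "pairwise orthogonal B" "\<And>b. b \<in> B \<Longrightarrow> norm b = 1"
    and d: "\<And>b. b \<in> B \<Longrightarrow> norm (d b - b) < \<epsilon>" and \<epsilon>: "real (card B) * \<epsilon> < 1"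
  shows "dim (d ` B) = card B"
proof -
  have "0 \<notin> B" using B(3) by fastforce
  then have ind: "independent B" using B(2) pairwise_orthogonal_independent by blast
  obtain f where f: "linear f" "\<And>b. b \<in> B \<Longrightarrow> f b = d b"
    using linear_independent_extend [OF ind, of d] by blast
  interpret f: linear f by (rule f(1))
  have "v = 0" if v: "v \<in> span B" "f v = 0" for v
  proof (rule ccontr)
    assume "v \<noteq> 0"
    obtain u where u: "v = (\<Sum>b\<in>B. u b *\<^sub>R b)"
      using v(1) unfolding span_finite [OF B(1)] by blast
    have ub: "\<bar>u c\<bar> \<le> norm v" if "c \<in> B" for c
    proof -
      have "v \<bullet> c = (\<Sum>b\<in>B. if b = c then u c else 0)"
        unfolding u inner_sum_left
      proof (rule sum.cong)
        fix b assume "b \<in> B"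
        have "c \<bullet> c = 1" using B(3) [OF that] by (simp add: norm_eq_1)
        then show "u b *\<^sub>R b \<bullet> c = (if b = c then u c else 0)"
          using B(2) that \<open>b \<in> B\<close> by (auto simp: pairwise_def orthogonal_def)
      qed simp
      then have "v \<bullet> c = u c" using B(1) that by simp
      then show ?thesis using Cauchy_Schwarz_ineq2 [of v c] B(3) [OF that] by simp
    qed
    have "v = - (\<Sum>b\<in>B. u b *\<^sub>R (d b - b))"
    proof -
      have "f v = (\<Sum>b\<in>B. u b *\<^sub>R d b)" unfolding u using f(2) by (simp add: f.sum f.scaleR)
      then show ?thesis using v(2) u by (simp add: scaleR_diff_right sum_subtractf)
    qed
    then have "norm v \<le> (\<Sum>b\<in>B. \<bar>u b\<bar> * norm (d b - b))"
      using sum_norm_le [of B "\<lambda>b. u b *\<^sub>R (d b - b)" "\<lambda>b. \<bar>u b\<bar> * norm (d b - b)"] by simp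
    also have "\<dots> \<le> (\<Sum>b\<in>B. norm v * \<epsilon>)"
      using ub d by (intro sum_mono mult_mono) (auto intro: less_imp_le)
    also have "\<dots> = norm v * (real (card B) * \<epsilon>)" by simp
    also have "\<dots> < norm v * 1" using \<epsilon> \<open>v \<noteq> 0\<close> by (intro mult_strict_left_mono) auto
    finally show False by simp
  qed
  then have "inj_on f (span B)"
    using linear_inj_on_iff_eq_0 [OF f(1) subspace_span] by blast
  then have "dim (f ` B) = dim B" using f(1) by (intro dim_image_eq) auto
  moreover have "f ` B = d ` B" using f(2) by (auto intro: image_cong)
  ultimately show ?thesis using dim_eq_card_independent [OF ind] by simp
qed

text \<open>For an orthonormal frame at \<open>p\<close>, approximations of \<open>p\<close> and of
  the points \<open>p + b\<close> in \<open>H y\<close> differ by vectors close to the frame, which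
  are therefore independent directions of \<open>H y\<close>.\<close>

lemma aff_dim_liminf_fiber:
  fixes H :: "'a \<Rightarrow> 'b::euclidean_space set"
  assumes "\<And>y. affine (H y)"
  shows "eventually (\<lambda>y. aff_dim (liminf_fiber F H) \<le> aff_dim (H y)) F"
proof (cases "liminf_fiber F H = {}")
  case True
  then show ?thesis by (simp add: aff_dim_geq)
next
  case False
  then obtain p where p: "p \<in> liminf_fiber F H" by blast
  from affine_orthonormal_frame [OF affine_liminf_fiber [OF assms] p] obtain B where B:
    "finite B" "pairwise orthogonal B" "\<forall>b\<in>B. norm b = 1"
    "aff_dim (liminf_fiber F H) = int (card B)" "\<forall>b\<in>B. p + b \<in> liminf_fiber F H" .
  \<comment> \<open>A difference of two approximations has error below
    \<open>2 * \<epsilon>\<close>, and \<open>card B\<close> times this must stay below 1; the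
    summand 2 also covers an empty frame.\<close>
  define \<epsilon> where "\<epsilon> = 1 / (2 * real (card B) + 2)"
  have \<epsilon>: "0 < \<epsilon>" "real (card B) * (2 * \<epsilon>) < 1" by (auto simp: \<epsilon>_def field_simps)
  have "eventually (\<lambda>y. \<exists>w\<in>H y. dist p w < \<epsilon>) F"
    using p \<epsilon>(1) by (simp add: liminf_fiber_def)
  moreover have "eventually (\<lambda>y. \<forall>b\<in>B. \<exists>w\<in>H y. dist (p + b) w < \<epsilon>) F"
    using B(1,5) \<epsilon>(1) by (intro eventually_ball_finite ballI) (simp_all add: liminf_fiber_def)
  ultimately show ?thesis
  proof eventually_elim
    case (elim y)
    then obtain w0 where w0: "w0 \<in> H y" "dist p w0 < \<epsilon>" by blast
    from elim obtain w where w: "\<And>b. b \<in> B \<Longrightarrow> w b \<in> H y \<and> dist (p + b) (w b) < \<epsilon>" by metis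
    define d where "d b = w b - w0" for b
    have "norm (d b - b) < 2 * \<epsilon>" if "b \<in> B" for b
    proof -
      have "d b - b = (p - w0) - ((p + b) - w b)" by (simp add: d_def)
      then have "norm (d b - b) \<le> dist p w0 + dist (p + b) (w b)"
        unfolding dist_norm by (metis norm_triangle_ineq4)
      then show ?thesis using w [OF that] w0 by simp
    qed
    then have "dim (d ` B) = card B"
      by (intro orthonormal_perturbation [where \<epsilon> = "2 * \<epsilon>"] B(1,2) bspec [OF B(3)] \<epsilon>(2))
    moreover have "d ` B \<subseteq> (\<lambda>x. x - w0) ` H y" using w by (auto simp: d_def)
    then have "dim (d ` B) \<le> dim ((\<lambda>x. x - w0) ` H y)" by (rule dim_subset)
    moreover have "aff_dim (H y) = int (dim ((\<lambda>x. x - w0) ` H y))"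
      by (intro aff_dim_eq_dim_subtract hull_inc w0(1))
    ultimately show ?case using B(4) by simp
  qed
qed

text \<open>Orthonormality is a polynomial condition, which makes a dimension bound first-order. The
  frame is stored as the rows indexed by \<open>J\<close> of one square matrix, so a single
  quantifier over a Euclidean space covers it.\<close>

lemma aff_dim_ge_iff_frame:
  fixes S :: "(real ^ 's) set"
  assumes "affine S"
  shows "int (card J) \<le> aff_dim S \<longleftrightarrow>
    (\<exists>p. \<exists>M :: real ^ 's ^ 's. p \<in> S \<and> (\<forall>j\<in>J. p + M $ j \<in> S) \<and>
      (\<forall>i\<in>J. \<forall>j\<in>J. M $ i \<bullet> M $ j = (if i = j then 1 else 0)))"
proof
  assume le: "int (card J) \<le> aff_dim S"
  then have "S \<noteq> {}" by auto
  then obtain p where p: "p \<in> S" by blast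
  from affine_orthonormal_frame [OF assms p] obtain B where B:
    "finite B" "pairwise orthogonal B" "\<forall>b\<in>B. norm b = 1"
    "aff_dim S = int (card B)" "\<forall>b\<in>B. p + b \<in> S" .
  have "card J \<le> card B" using le B(4) by simp
  then obtain h where h: "h ` J \<subseteq> B" "inj_on h J"
    using card_le_inj [OF finite B(1), of J] by blast
  define M :: "real ^ 's ^ 's" where "M = (\<chi> j. h j)"
  have "M $ i \<bullet> M $ j = (if i = j then 1 else 0)" if "i \<in> J" "j \<in> J" for i j
  proof -
    have "h i \<in> B" "h j \<in> B" "h i = h j \<longleftrightarrow> i = j" using h that by (auto simp: inj_on_def)
    then show ?thesis using B(2,3) by (auto simp: M_def pairwise_def orthogonal_def norm_eq_1)
  qed
  moreover have "p + M $ j \<in> S" if "j \<in> J" for j using B(5) h(1) that by (auto simp: M_def)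
  ultimately show "\<exists>p. \<exists>M :: real ^ 's ^ 's. p \<in> S \<and> (\<forall>j\<in>J. p + M $ j \<in> S) \<and>
      (\<forall>i\<in>J. \<forall>j\<in>J. M $ i \<bullet> M $ j = (if i = j then 1 else 0))"
    using p by blast
next
  assume "\<exists>p. \<exists>M :: real ^ 's ^ 's. p \<in> S \<and> (\<forall>j\<in>J. p + M $ j \<in> S) \<and>
      (\<forall>i\<in>J. \<forall>j\<in>J. M $ i \<bullet> M $ j = (if i = j then 1 else 0))"
  then obtain p and M :: "real ^ 's ^ 's" where pM: "p \<in> S" "\<And>j. j \<in> J \<Longrightarrow> p + M $ j \<in> S"
      "\<And>i j. i \<in> J \<Longrightarrow> j \<in> J \<Longrightarrow> M $ i \<bullet> M $ j = (if i = j then 1 else 0)" by blast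
  have inj: "inj_on (($) M) J"
  proof (rule inj_onI, rule ccontr)
    fix i j assume "i \<in> J" "j \<in> J" "M $ i = M $ j" "i \<noteq> j"
    then show False using pM(3) [of i j] pM(3) [of i i] by simp
  qed
  have "pairwise orthogonal (($) M ` J)"
    using pM(3) by (auto simp: pairwise_def orthogonal_def)
  moreover have "0 \<notin> ($) M ` J" using pM(3) by force
  ultimately have "independent (($) M ` J)" by (rule pairwise_orthogonal_independent)
  moreover have "($) M ` J \<subseteq> (\<lambda>x. x - p) ` S"
  proof
    fix x assume "x \<in> ($) M ` J"
    then have "p + x \<in> S" using pM(2) by auto
    then show "x \<in> (\<lambda>x. x - p) ` S" by (intro image_eqI [of _ _ "p + x"]) simp_all
  qed
  ultimately have "card (($) M ` J) \<le> dim ((\<lambda>x. x - p) ` S)"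
    using independent_card_le_dim by blast
  moreover have "aff_dim S = int (dim ((\<lambda>x. x - p) ` S))"
    by (intro aff_dim_eq_dim_subtract hull_inc pM(1))
  ultimately show "int (card J) \<le> aff_dim S" using card_image [OF inj] by simp
qed

section \<open>Stabilisation of the Glaeser refinements\<close>

lemma glaeser_iter_0 [simp]: "glaeser_iter Q H 0 = H"
  by (simp add: glaeser_iter_def)

lemma glaeser_iter_Suc [simp]:
  "glaeser_iter Q H (Suc k) = glaeser_refine Q (glaeser_iter Q H k)"
  by (simp add: glaeser_iter_def)

lemma glaeser_refine_subset: "glaeser_refine Q H x \<subseteq> H x"
  by (auto simp: glaeser_refine_def)

lemma affine_glaeser_refine:
  fixes H :: "'a::metric_space \<Rightarrow> 'b::real_normed_vector set"
  shows "(\<And>y. affine (H y)) \<Longrightarrow> affine (glaeser_refine Q H x)"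
  unfolding glaeser_refine_eq by (intro affine_Int affine_liminf_fiber)

lemma affine_glaeser_iter:
  fixes H :: "'a::metric_space \<Rightarrow> 'b::real_normed_vector set"
  assumes "\<And>y. affine (H y)"
  shows "affine (glaeser_iter Q H k x)"
  using assms by (induction k arbitrary: x) (simp_all add: affine_glaeser_refine)

text \<open>Only fibers near \<open>x\<close> enter the limit. Stability can therefore be propagated
  on an open set without knowing the bundle elsewhere.\<close>

lemma glaeser_refine_cong_open:
  assumes U: "open U" "x \<in> U" and x: "x \<in> Q" and eq: "\<And>y. y \<in> Q \<inter> U \<Longrightarrow> H y = H' y"
  shows "glaeser_refine Q H x = glaeser_refine Q H' x"
proof -
  have "eventually (\<lambda>y. y \<in> Q \<inter> U) (at x within Q)"
    unfolding eventually_at_filter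
    by (rule eventually_mono [OF eventually_nhds_in_open [OF U]]) simp
  then have ev: "eventually (\<lambda>y. H y = H' y) (at x within Q)"
    by (rule eventually_mono) (rule eq)
  have "eventually (\<lambda>y. \<exists>w\<in>H y. dist v w < e) (at x within Q) \<longleftrightarrow>
      eventually (\<lambda>y. \<exists>w\<in>H' y. dist v w < e) (at x within Q)" for v e
    by (rule eventually_cong [OF ev]) simp
  then have "liminf_fiber (at x within Q) H = liminf_fiber (at x within Q) H'"
    by (simp add: liminf_fiber_def)
  then show ?thesis using eq [of x] x U by (simp add: glaeser_refine_eq)
qed

lemma glaeser_iter_stable_on_open:
  assumes "open U" and "\<And>y. y \<in> Q \<inter> U \<Longrightarrow> glaeser_iter Q H (Suc k) y = glaeser_iter Q H k y"
    and "k \<le> l" and "x \<in> Q \<inter> U"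
  shows "glaeser_iter Q H l x = glaeser_iter Q H k x"
  using assms(3,4)
proof (induction l arbitrary: x rule: dec_induct)
  case (step l)
  have "glaeser_iter Q H (Suc l) x = glaeser_refine Q (glaeser_iter Q H l) x" by simp
  also have "\<dots> = glaeser_refine Q (glaeser_iter Q H k) x"
    using step by (intro glaeser_refine_cong_open [OF assms(1)]) auto
  also have "\<dots> = glaeser_iter Q H k x" using assms(2) step.prems by simp
  finally show ?case .
qed simp

lemma eventually_at_within_openE:
  assumes "eventually P (at x within Q)"
  obtains U where "open U" "x \<in> U" "\<forall>y\<in>Q \<inter> U. y \<noteq> x \<longrightarrow> P y"
  using assms unfolding eventually_at_topological by blast

text \<open>Fefferman's argument: as long as the refinements keep changing the bundle near a point, every
  second step lowers the dimension of the fiber there.\<close>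

lemma glaeser_iter_stable_large_dim:
  fixes H :: "'a::metric_space \<Rightarrow> 'b::euclidean_space set"
  assumes aff: "\<And>y. affine (H y)" and "x \<in> Q"
    and "int DIM('b) + 1 - int k \<le> aff_dim (glaeser_iter Q H (2 * k) x)"
    and "2 * k \<le> l"
  shows "glaeser_iter Q H l x = glaeser_iter Q H (2 * k) x"
  using assms(2-)
proof (induction k arbitrary: x l)
  case 0
  then show ?case using aff_dim_le_DIM [of "H x"] by simp
next
  case (Suc k)
  let ?H = "glaeser_iter Q H"
  note aff' = affine_glaeser_iter [OF aff]
  show ?case
  proof (cases "int DIM('b) + 1 - int k \<le> aff_dim (?H (2 * k) x)")
    case True
    then have "?H l x = ?H (2 * k) x" "?H (2 * Suc k) x = ?H (2 * k) x"
      using Suc.IH [OF Suc.prems(1) True, of l] Suc.IH [OF Suc.prems(1) True, of "2 * Suc k"] Suc.prems(3)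
      by simp_all
    then show ?thesis by simp
  next
    case False
    \<comment> \<open>At \<open>x\<close> the dimensions from stage \<open>2 * k\<close> to stage
      \<open>2 * k + 2\<close> decrease from at most \<open>m\<close> to at least \<open>m\<close>,
      so all of them equal \<open>m\<close>.\<close>
    define m where "m = int DIM('b) - int k"
    have sub: "?H (Suc n) y \<subseteq> ?H n y" for n y by (simp add: glaeser_refine_subset)
    have eq: "?H (Suc n) y = ?H n y" if "m \<le> aff_dim (?H (Suc n) y)" "aff_dim (?H n y) \<le> m" for n y
    proof -
      have "aff_dim (?H (Suc n) y) \<le> aff_dim (?H n y)" by (rule aff_dim_subset [OF sub])
      then have "aff_dim (?H (Suc n) y) = aff_dim (?H n y)" using that by linarith
      then show ?thesis
        using affine_dim_equal [OF aff' aff' _ sub] by (metis aff_dim_empty)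
    qed
    have m2: "m \<le> aff_dim (?H (Suc (Suc (2 * k))) x)" using Suc.prems(2) by (simp add: m_def)
    also have "\<dots> \<le> aff_dim (?H (Suc (2 * k)) x)" by (rule aff_dim_subset [OF sub])
    finally have m1: "m \<le> aff_dim (?H (Suc (2 * k)) x)" .
    have "aff_dim (?H (2 * k) x) \<le> m" using False by (simp add: m_def)
    then have eqx: "?H (Suc (2 * k)) x = ?H (2 * k) x" using m1 by (intro eq)
    have ev: "eventually (\<lambda>y. m \<le> aff_dim (?H n y)) (at x within Q)"
      if "m \<le> aff_dim (?H (Suc n) x)" for n
    proof -
      have "?H (Suc n) x \<subseteq> liminf_fiber (at x within Q) (?H n)"
        by (simp add: glaeser_refine_eq)
      then have "m \<le> aff_dim (liminf_fiber (at x within Q) (?H n))"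
        using that aff_dim_subset order_trans by blast
      moreover have "eventually (\<lambda>y. aff_dim (liminf_fiber (at x within Q) (?H n)) \<le> aff_dim (?H n y))
          (at x within Q)"
        by (intro aff_dim_liminf_fiber aff')
      ultimately show ?thesis by (auto elim!: eventually_mono)
    qed
    \<comment> \<open>The fiber at stage \<open>2 * k + 2\<close> lies in the lower limit of stage
      \<open>2 * k + 1\<close>, which bounds the nearby dimensions from below. This is why each
      dimension costs two refinements.\<close>
    have "eventually (\<lambda>y. m \<le> aff_dim (?H (Suc (2 * k)) y)) (at x within Q)"
      using ev m2 by blast
    then obtain U where U: "open U" "x \<in> U"
      "\<forall>y\<in>Q \<inter> U. y \<noteq> x \<longrightarrow> m \<le> aff_dim (?H (Suc (2 * k)) y)"
      by (rule eventually_at_within_openE)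
    \<comment> \<open>Near \<open>x\<close>, a fiber of dimension at most \<open>m\<close> keeps
      dimension at least \<open>m\<close> and so cannot shrink; a fiber of larger dimension is
      stable by the induction hypothesis.\<close>
    have "?H (Suc (2 * k)) y = ?H (2 * k) y" if "y \<in> Q \<inter> U" for y
    proof (cases "y = x \<or> aff_dim (?H (2 * k) y) \<le> m")
      case True
      then show ?thesis using eqx eq bspec [OF U(3) that] by blast
    next
      case False
      then have "int DIM('b) + 1 - int k \<le> aff_dim (?H (2 * k) y)" by (simp add: m_def)
      then show ?thesis using Suc.IH [of y "Suc (2 * k)"] that by simp
    qed
    then have "?H n x = ?H (2 * k) x" if "2 * k \<le> n" for n
      using glaeser_iter_stable_on_open [OF U(1), of Q H "2 * k" n x] that U(2) Suc.prems(1) by blast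
    note stable = this
    have "?H l x = ?H (2 * k) x" by (rule stable) (use Suc.prems(3) in simp)
    moreover have "?H (2 * Suc k) x = ?H (2 * k) x" by (rule stable) simp
    ultimately show ?thesis by (simp only:)
  qed
qed

lemma glaeser_stable_properties:
  fixes H :: "'a::metric_space \<Rightarrow> 'b::euclidean_space set"
  assumes aff: "\<And>y. affine (H y)"
  obtains k where "glaeser_stable Q H = glaeser_iter Q H k"
    and "\<And>x. x \<in> Q \<Longrightarrow> glaeser_refine Q (glaeser_stable Q H) x = glaeser_stable Q H x"
proof -
  \<comment> \<open>For this \<open>k\<close> the dimension bound becomes \<open>-1\<close>, the
    dimension of the empty set, so it holds for every fiber.\<close>
  let ?k = "DIM('b) + 2"
  have "glaeser_iter Q H k x = glaeser_iter Q H (2 * ?k) x" if "2 * ?k \<le> k" "x \<in> Q" for k x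
    using that aff_dim_geq [of "glaeser_iter Q H (2 * ?k) x"]
    by (intro glaeser_iter_stable_large_dim [OF aff]) auto
  then have "\<exists>k0. \<forall>k\<ge>k0. \<forall>x\<in>Q. glaeser_iter Q H k x = glaeser_iter Q H k0 x" by blast
  then have "\<forall>k\<ge>glaeser_index Q H. \<forall>x\<in>Q. glaeser_iter Q H k x = glaeser_stable Q H x"
    unfolding glaeser_index_def glaeser_stable_def by (rule LeastI_ex)
  from this [rule_format, of "Suc (glaeser_index Q H)"]
  show ?thesis using that [of "glaeser_index Q H"] by (simp add: glaeser_stable_def)
qed

section \<open>A semialgebraic Tietze extension\<close>

text \<open>
  Riesz's explicit extension formula is preferred to a partition of unity because it is
  evidently semialgebraic; it needs \<open>f\<close> to be positive.
\<close>

lemma semialgebraic_tietze_real: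
  fixes f :: "'a::euclidean_space \<Rightarrow> real"
  assumes E: "closed E" "E \<noteq> {}" "semialgebraic E"
    and f: "semialgebraic_fun f" "continuous_on E f" and bnd: "\<And>y. y \<in> E \<Longrightarrow> 1 \<le> f y \<and> f y \<le> M"
  obtains F where "semialgebraic_fun F" "continuous_on UNIV F" "\<And>x. x \<in> E \<Longrightarrow> F x = f x"
proof -
  have M: "1 \<le> M" using E(2) bnd by force
  define h where "h x y = \<bar>f y\<bar> * dist x y" for x y
  define g where "g x = (INF y\<in>E. h x y)" for x
  \<comment> \<open>For \<open>f = 1\<close> the infimum would be \<open>infdist x E\<close>, so off
    \<open>E\<close> the quotient lies between the bounds of \<open>f\<close>; near a point of
    \<open>E\<close> it is governed by the values of \<open>f\<close> close by.\<close>
  define F where "F x = (if x \<in> E then f x else g x / infdist x E)" for x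
  have bdd: "bdd_below (h x ` E)" for x
    by (rule bdd_belowI2 [of _ 0]) (simp add: h_def)
  have g_le: "g x \<le> f y * dist x y" if "y \<in> E" for x y
    using cINF_lower [OF bdd that, of x] bnd [OF that] by (simp add: g_def h_def)
  have g_ge: "c \<le> g x" if "\<And>y. y \<in> E \<Longrightarrow> c \<le> f y * dist x y" for c x
    unfolding g_def
  proof (rule cINF_greatest [OF E(2)])
    fix y assume "y \<in> E"
    then show "c \<le> h x y" using that [of y] bnd [of y] by (simp add: h_def)
  qed
  have "semialgebraic_fun (\<lambda>z. h (fst z) (snd z))"
    unfolding h_def real_norm_def [symmetric]
    by (intro semialgebraic_intros semialgebraic_fun_compose [OF _ f(1)])
  then have "semialgebraic_fun g"
    unfolding g_def by (intro semialgebraic_fun_INF E bdd)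
  moreover have "semialgebraic {x. x \<in> E}" using E(3) by simp
  ultimately have "semialgebraic_fun F"
    unfolding F_def by (intro semialgebraic_fun_If semialgebraic_fun_divide semialgebraic_fun_infdist f(1) E(3))
  moreover have "continuous_on UNIV F"
  proof -
    \<comment> \<open>An infimum of functions with Lipschitz constant at most \<open>M\<close> is
      again Lipschitz with constant \<open>M\<close>.\<close>
    have lip: "g x - g x' \<le> M * dist x x'" for x x'
    proof -
      have "g x - M * dist x x' \<le> g x'"
      proof (rule g_ge)
        fix y assume y: "y \<in> E"
        have "g x \<le> f y * dist x y" by (rule g_le [OF y])
        also have "\<dots> \<le> f y * (dist x x' + dist x' y)"
          using bnd [OF y] dist_triangle by (intro mult_left_mono) auto
        also have "\<dots> \<le> M * dist x x' + f y * dist x' y"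
          using bnd [OF y] by (simp add: distrib_left mult_right_mono)
        finally show "g x - M * dist x x' \<le> f y * dist x' y" by simp
      qed
      then show ?thesis by simp
    qed
    have "M-lipschitz_on UNIV g"
    proof (rule lipschitz_onI)
      show "dist (g x) (g x') \<le> M * dist x x'" for x x'
        using lip [of x x'] lip [of x' x] by (simp add: dist_real_def dist_commute abs_le_iff)
    qed (use M in simp)
    then have cg: "continuous_on UNIV g" by (rule lipschitz_on_continuous_on)
    have "isCont F x" for x
    proof (cases "x \<in> E")
      case False
      have "continuous_on (- E) (\<lambda>x. g x / infdist x E)"
      proof (intro continuous_intros ballI)
        show "continuous_on (- E) g" by (rule continuous_on_subset [OF cg]) simp
        show "infdist x E \<noteq> 0" if "x \<in> - E" for x
          using that in_closed_iff_infdist_zero [OF E(1,2)] by auto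
      qed
      then have "continuous_on (- E) F"
        by (rule continuous_on_eq) (simp add: F_def)
      then show ?thesis
        using False E(1) by (simp add: continuous_on_eq_continuous_at open_Compl)
    next
      case True
      show ?thesis
        unfolding continuous_at_eps_delta
      proof (intro allI impI)
        fix e :: real assume "0 < e"
        then have "0 < e / 2" by simp
        then obtain \<delta> where \<delta>: "0 < \<delta>" "\<And>y. y \<in> E \<Longrightarrow> dist y x < \<delta> \<Longrightarrow> dist (f y) (f x) < e / 2"
          using f(2) True unfolding continuous_on_iff by blast
        \<comment> \<open>Chosen so that, for \<open>x'\<close> within \<open>\<eta>\<close> of
          \<open>x\<close>, points of \<open>E\<close> at distance at least \<open>\<delta>\<close>
          from \<open>x\<close> are at distance at least \<open>M * \<eta>\<close> from
          \<open>x'\<close>. Moreover \<open>2 * \<eta> \<le> \<delta>\<close> keeps the point of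
          \<open>E\<close> nearest to \<open>x'\<close> within \<open>\<delta>\<close> of
          \<open>x\<close>.\<close>
        define \<eta> where "\<eta> = \<delta> / (M + 1)"
        have "(M + 1) * \<eta> = \<delta>" using M by (simp add: \<eta>_def)
        then have M\<eta>: "M * \<eta> + \<eta> = \<delta>" by (simp add: algebra_simps)
        have \<eta>: "0 < \<eta>" using M \<delta>(1) by (simp add: \<eta>_def)
        have "1 * \<eta> \<le> M * \<eta>" using M \<eta> by (intro mult_right_mono) auto
        then have \<eta>2: "2 * \<eta> \<le> \<delta>" "\<eta> \<le> \<delta>" using M\<eta> \<eta> by auto
        have "dist (F x') (F x) < e" if x': "dist x' x < \<eta>" for x'
        proof (cases "x' \<in> E")
          case True
          then have "dist (f x') (f x) < e / 2" using \<delta>(2) x' \<eta>2 by simp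
          then show ?thesis using True \<open>x \<in> E\<close> \<open>0 < e\<close> by (simp add: F_def)
        next
          case False
          define d where "d = infdist x' E"
          have d: "0 < d" "d \<le> dist x' x"
            using False in_closed_iff_infdist_zero [OF E(1,2), of x'] infdist_nonneg [of x' E]
              infdist_le [OF \<open>x \<in> E\<close>, of x'] by (auto simp: d_def)
          obtain y0 where y0: "y0 \<in> E" "d = dist x' y0"
            using infdist_attains_inf [OF E(1,2), of x'] d_def by metis
          have "dist y0 x \<le> dist x' y0 + dist x' x" by (metis dist_commute dist_triangle)
          then have "dist y0 x < \<delta>" using y0(2) d(2) x' \<eta>2 by linarith
          then have "f y0 < f x + e / 2" using \<delta>(2) [OF y0(1)] unfolding dist_real_def by linarith
          then have "f y0 * d < (f x + e / 2) * d"
            using d(1) by (rule mult_strict_right_mono)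
          then have "g x' < (f x + e / 2) * d"
            using g_le [OF y0(1), of x'] unfolding y0(2) [symmetric] by linarith
          moreover have "(f x - e / 2) * d \<le> g x'"
          proof (rule g_ge)
            fix y assume y: "y \<in> E"
            have dy: "d \<le> dist x' y" unfolding d_def by (rule infdist_le [OF y])
            show "(f x - e / 2) * d \<le> f y * dist x' y"
            proof (cases "dist y x < \<delta>")
              case True
              then have "f x - e / 2 \<le> f y" using \<delta>(2) [OF y] unfolding dist_real_def by linarith
              then have "(f x - e / 2) * d \<le> f y * d" using d(1) by (intro mult_right_mono) auto
              also have "\<dots> \<le> f y * dist x' y" using dy bnd [OF y] by (intro mult_left_mono) auto
              finally show ?thesis .
            next
              \<comment> \<open>Far points cannot undercut the bound: since
                \<open>1 \<le> f y\<close>, they contribute at least \<open>M * \<eta>\<close>,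
                which exceeds \<open>M * d\<close>.\<close>
              case False
              have "dist y x \<le> dist x' y + dist x' x" by (metis dist_commute dist_triangle)
              then have "M * \<eta> \<le> dist x' y" using False x' M\<eta> by linarith
              have "(f x - e / 2) * d \<le> M * d"
                using bnd [OF \<open>x \<in> E\<close>] d(1) \<open>0 < e\<close> by (intro mult_right_mono) auto
              also have "\<dots> \<le> M * \<eta>" using d(2) x' M by (intro mult_left_mono) auto
              also have "\<dots> \<le> dist x' y" by fact
              also have "\<dots> \<le> f y * dist x' y"
                using bnd [OF y] mult_right_mono [of 1 "f y" "dist x' y"] by simp
              finally show ?thesis .
            qed
          qed
          ultimately have "f x - e / 2 \<le> g x' / d" "g x' / d < f x + e / 2"
            using d(1) by (simp_all add: field_simps)
          then show ?thesis
            using False \<open>x \<in> E\<close> \<open>0 < e\<close> by (simp add: F_def d_def dist_real_def abs_less_iff)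
        qed
        then show "\<exists>d>0. \<forall>x'. dist x' x < d \<longrightarrow> dist (F x') (F x) < e" using \<eta> by blast
      qed
    qed
    then show ?thesis by (simp add: continuous_on_eq_continuous_at)
  qed
  ultimately show ?thesis using that [of F] by (simp add: F_def)
qed

lemma semialgebraic_tietze:
  fixes f :: "'a::euclidean_space \<Rightarrow> 'b::euclidean_space"
  assumes E: "compact E" "semialgebraic E" and f: "semialgebraic_fun f" "continuous_on E f"
  obtains F where "semialgebraic_fun F" "continuous_on UNIV F" "\<And>x. x \<in> E \<Longrightarrow> F x = f x"
proof (cases "E = {}")
  case True
  then show ?thesis using that [of "\<lambda>_. 0"] semialgebraic_fun_const [of "0::'b"] by simp
next
  case False
  have "bounded (f ` E)" using E(1) f(2) compact_continuous_image compact_imp_bounded by blast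
  then obtain K where K: "\<And>x. x \<in> E \<Longrightarrow> norm (f x) \<le> K" unfolding bounded_iff by blast
  \<comment> \<open>Components are bounded by \<open>K\<close> in absolute value, so the shift by
    \<open>K + 1\<close> puts them between \<open>1\<close> and \<open>2 * K + 1\<close>, as the
    scalar extension requires. It is undone in \<open>G\<close>.\<close>
  have "\<exists>F. semialgebraic_fun F \<and> continuous_on UNIV F \<and> (\<forall>x\<in>E. F x = f x \<bullet> b + (K + 1))"
    if "b \<in> Basis" for b
  proof (rule semialgebraic_tietze_real [OF compact_imp_closed [OF E(1)] False E(2)])
    show "semialgebraic_fun (\<lambda>x. f x \<bullet> b + (K + 1))" by (intro semialgebraic_intros f(1))
    show "continuous_on E (\<lambda>x. f x \<bullet> b + (K + 1))" by (intro continuous_intros f(2))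
    show "1 \<le> f x \<bullet> b + (K + 1) \<and> f x \<bullet> b + (K + 1) \<le> 2 * K + 1" if "x \<in> E" for x
      using Basis_le_norm [OF \<open>b \<in> Basis\<close>, of "f x"] K [OF that] by auto
  qed blast
  then obtain F where F: "\<And>b. b \<in> Basis \<Longrightarrow> semialgebraic_fun (F b)"
    "\<And>b. b \<in> Basis \<Longrightarrow> continuous_on UNIV (F b)"
    "\<And>b x. b \<in> Basis \<Longrightarrow> x \<in> E \<Longrightarrow> F b x = f x \<bullet> b + (K + 1)" by metis
  define G where "G x = (\<Sum>b\<in>Basis. (F b x - (K + 1)) *\<^sub>R b)" for x
  show ?thesis
  proof (rule that [of G])
    show "semialgebraic_fun G"
      unfolding G_def by (intro semialgebraic_intros finite_Basis F(1))
    show "continuous_on UNIV G"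
      unfolding G_def by (intro continuous_intros F(2))
    show "G x = f x" if "x \<in> E" for x
      using F(3) that by (simp add: G_def euclidean_representation)
  qed
qed

section \<open>Semialgebraic bundles\<close>

definition semialgebraic_bundle ::
    "'a::euclidean_space set \<Rightarrow> ('a \<Rightarrow> 'b::euclidean_space set) \<Rightarrow> bool" where
  "semialgebraic_bundle Q H \<longleftrightarrow> semialgebraic {z. fst z \<in> Q \<and> snd z \<in> H (fst z)}"

text \<open>The epsilon-delta form of the lower limit is first-order over the total space
  \<open>G\<close> of the bundle.\<close>

lemma semialgebraic_bundle_refine:
  assumes Q: "semialgebraic Q" and H: "semialgebraic_bundle Q H"
  shows "semialgebraic_bundle Q (glaeser_refine Q H)"
proof -
  define G where "G = {z. fst z \<in> Q \<and> snd z \<in> H (fst z)}"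
  have G: "semialgebraic G" using H by (simp add: G_def semialgebraic_bundle_def)
  have "semialgebraic {z. z \<in> G \<and> (\<forall>e. 0 < e \<longrightarrow> (\<exists>d. 0 < d \<and> (\<forall>y\<in>Q.
      \<not> y = fst z \<and> dist y (fst z) < d \<longrightarrow> (\<exists>w. (y, w) \<in> G \<and> dist (snd z) w < e))))}"
    by (intro semialgebraic_intros Q G)
  moreover have "(z \<in> G \<and> (\<forall>e. 0 < e \<longrightarrow> (\<exists>d. 0 < d \<and> (\<forall>y\<in>Q.
      \<not> y = fst z \<and> dist y (fst z) < d \<longrightarrow> (\<exists>w. (y, w) \<in> G \<and> dist (snd z) w < e)))))
      \<longleftrightarrow> fst z \<in> Q \<and> snd z \<in> glaeser_refine Q H (fst z)" for z
    by (auto simp: G_def glaeser_refine_eq liminf_fiber_def eventually_at Bex_def)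
  ultimately show ?thesis by (simp add: semialgebraic_bundle_def)
qed

lemma semialgebraic_bundle_iter:
  assumes "semialgebraic Q" and "semialgebraic_bundle Q H"
  shows "semialgebraic_bundle Q (glaeser_iter Q H k)"
  using assms by (induction k) (simp_all add: semialgebraic_bundle_refine)

lemma semialgebraic_bundle_solution:
  fixes A :: "'a::euclidean_space \<Rightarrow> real ^ 's ^ 'r" and \<gamma> :: "'a \<Rightarrow> real ^ 'r"
  assumes Q: "semialgebraic Q" and A: "\<And>i j. semialgebraic_fun (\<lambda>x. A x $ i $ j)"
    and \<gamma>: "\<And>i. semialgebraic_fun (\<lambda>x. \<gamma> x $ i)"
  shows "semialgebraic_bundle Q (solution_bundle A \<gamma>)"
proof -
  have "semialgebraic {z. fst z \<in> Q \<and>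
      (\<forall>i\<in>UNIV. (\<Sum>j\<in>UNIV. A (fst z) $ i $ j * (snd z :: real ^ 's) $ j) = \<gamma> (fst z) $ i)}"
    by (intro semialgebraic_conj semialgebraic_mem [OF Q] semialgebraic_Ball_finite semialgebraic_eq
        semialgebraic_fun_sum semialgebraic_fun_mult finite semialgebraic_fun_fst'
        semialgebraic_fun_compose [OF semialgebraic_fun_fst' A]
        semialgebraic_fun_compose [OF semialgebraic_fun_fst' \<gamma>]
        semialgebraic_fun_vec_nth [OF semialgebraic_fun_snd'])
  then show ?thesis
    by (simp add: semialgebraic_bundle_def solution_bundle_def vec_eq_iff matrix_vector_mult_def)
qed

lemma affine_solution_bundle: "affine (solution_bundle A \<gamma> x)"
  unfolding affine_def solution_bundle_def
  by (auto simp: matrix_vector_right_distrib matrix_vector_mult_scaleR scaleR_add_left [symmetric])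

lemma semialgebraic_low_dim:
  fixes H :: "'a::euclidean_space \<Rightarrow> (real ^ 's) set"
  assumes Q: "semialgebraic Q" and H: "semialgebraic_bundle Q H" and aff: "\<And>x. affine (H x)"
    and m: "m \<le> CARD('s)"
  shows "semialgebraic {x \<in> Q. aff_dim (H x) < int m}"
proof -
  obtain J :: "'s set" where J: "card J = m"
    using m obtain_subset_with_card_n [of m "UNIV :: 's set"] by blast
  define G where "G = {z. fst z \<in> Q \<and> snd z \<in> H (fst z)}"
  have G: "semialgebraic G" using H by (simp add: G_def semialgebraic_bundle_def)
  have "semialgebraic {x. x \<in> Q \<and> \<not> (\<exists>p. \<exists>M :: real ^ 's ^ 's. (x, p) \<in> G \<and>
      (\<forall>j\<in>J. (x, p + M $ j) \<in> G) \<and>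
      (\<forall>i\<in>J. \<forall>j\<in>J. M $ i \<bullet> M $ j = (if i = j then 1 else 0)))}"
    by (intro semialgebraic_Ball_finite finite semialgebraic_intros Q G)
  moreover have "(x \<in> Q \<and> \<not> (\<exists>p. \<exists>M :: real ^ 's ^ 's. (x, p) \<in> G \<and>
      (\<forall>j\<in>J. (x, p + M $ j) \<in> G) \<and>
      (\<forall>i\<in>J. \<forall>j\<in>J. M $ i \<bullet> M $ j = (if i = j then 1 else 0)))) \<longleftrightarrow>
      x \<in> Q \<and> aff_dim (H x) < int m" for x
    using aff_dim_ge_iff_frame [OF aff, of J x] J by (auto simp: G_def not_le [symmetric])
  ultimately show ?thesis by simp
qed

section \<open>Semialgebraic selections of stable bundles\<close>

text \<open>By Bolzano-Weierstrass, a subsequence staying away from \<open>a\<close> would have a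
  further subsequence converging to a limit other than \<open>a\<close>.\<close>

lemma tendsto_unique_cluster:
  fixes f :: "nat \<Rightarrow> 'a::euclidean_space"
  assumes "Bseq f" and cluster: "\<And>r l. strict_mono r \<Longrightarrow> (f \<circ> r) \<longlonglongrightarrow> l \<Longrightarrow> l = a"
  shows "f \<longlonglongrightarrow> a"
proof (rule ccontr)
  assume "\<not> f \<longlonglongrightarrow> a"
  then obtain e where e: "0 < e" "\<not> eventually (\<lambda>n. dist (f n) a < e) sequentially"
    unfolding tendsto_iff by blast
  then have inf: "\<And>N. \<exists>n\<ge>N. e \<le> dist (f n) a"
    unfolding eventually_sequentially by (meson not_le)
  then have "infinite {n. e \<le> dist (f n) a}"
    unfolding infinite_nat_iff_unbounded_le by blast
  then obtain r :: "nat \<Rightarrow> nat" where r: "strict_mono r" "\<And>n. e \<le> dist (f (r n)) a"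
    using infinite_enumerate by blast
  have "bounded (range (f \<circ> r))"
    using assms(1) unfolding Bseq_eq_bounded by (rule bounded_subset) auto
  then obtain l s where s: "strict_mono s" "((f \<circ> r) \<circ> s) \<longlonglongrightarrow> l"
    using bounded_imp_convergent_subsequence by blast
  then have "l = a"
    using cluster [of "r \<circ> s" l] r(1) by (simp add: strict_mono_o comp_assoc)
  then have "eventually (\<lambda>n. dist (((f \<circ> r) \<circ> s) n) a < e) sequentially"
    using s(2) e(1) by (auto dest: tendstoD)
  then obtain n where "dist (f (r (s n))) a < e"
    unfolding eventually_sequentially by auto
  then show False using r(2) [of "s n"] by simp
qed

text \<open>By stability the dimension is lower semicontinuous on \<open>Q\<close>: a fiber of
  dimension at least \<open>d\<close> forces this dimension on all nearby fibers.\<close>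

lemma closed_low_dim:
  fixes H :: "'a::euclidean_space \<Rightarrow> 'b::euclidean_space set"
  assumes "closed Q" and aff: "\<And>x. affine (H x)"
    and stable: "\<And>x. x \<in> Q \<Longrightarrow> H x \<subseteq> liminf_fiber (at x within Q) H"
  shows "closed {x \<in> Q. aff_dim (H x) < d}"
  unfolding closed_limpt
proof (intro allI impI)
  fix x assume lim: "x islimpt {x \<in> Q. aff_dim (H x) < d}"
  then have "x islimpt Q" by (rule islimpt_subset) auto
  then have x: "x \<in> Q" using assms(1) by (simp add: closed_limpt)
  have "aff_dim (H x) < d"
  proof (rule ccontr)
    assume "\<not> aff_dim (H x) < d"
    then have "d \<le> aff_dim (liminf_fiber (at x within Q) H)"
      using aff_dim_subset [OF stable [OF x]] by linarith
    moreover have "eventually (\<lambda>y. aff_dim (liminf_fiber (at x within Q) H) \<le> aff_dim (H y))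
        (at x within Q)"
      by (intro aff_dim_liminf_fiber aff)
    ultimately have "eventually (\<lambda>y. d \<le> aff_dim (H y)) (at x within Q)"
      by (auto elim!: eventually_mono)
    then obtain U where U: "open U" "x \<in> U" "\<forall>y\<in>Q \<inter> U. y \<noteq> x \<longrightarrow> d \<le> aff_dim (H y)"
      by (rule eventually_at_within_openE)
    obtain y where "y \<in> {x \<in> Q. aff_dim (H x) < d}" "y \<in> U" "y \<noteq> x"
      using lim U(2,1) by (rule islimptE)
    then show False using U(3) by fastforce
  qed
  then show "x \<in> {x \<in> Q. aff_dim (H x) < d}" using x by simp
qed

text \<open>The filter \<open>at x within Q\<close> ignores \<open>x\<close> itself, but a sequence
  may hit \<open>x\<close>; those terms are covered by \<open>v \<in> H x\<close>.\<close>

lemma liminf_fiber_sequentially: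
  fixes H :: "'a::metric_space \<Rightarrow> 'b::metric_space set"
  assumes "v \<in> H x" "v \<in> liminf_fiber (at x within Q) H"
    and "y \<longlonglongrightarrow> x" "\<And>n. y n \<in> Q"
  shows "v \<in> liminf_fiber sequentially (\<lambda>n. H (y n))"
  unfolding liminf_fiber_def
proof (intro CollectI allI impI)
  fix e :: real assume "0 < e"
  then have "eventually (\<lambda>y. y \<noteq> x \<longrightarrow> y \<in> Q \<longrightarrow> (\<exists>w\<in>H y. dist v w < e)) (nhds x)"
    using assms(2) by (simp add: liminf_fiber_def eventually_at_filter)
  then have "eventually (\<lambda>n. y n \<noteq> x \<longrightarrow> y n \<in> Q \<longrightarrow> (\<exists>w\<in>H (y n). dist v w < e)) sequentially"
    using assms(3) by (rule eventually_compose_filterlim)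
  then show "eventually (\<lambda>n. \<exists>w\<in>H (y n). dist v w < e) sequentially"
  proof eventually_elim
    case (elim n)
    show ?case
    proof (cases "y n = x")
      case True
      then show ?thesis using assms(1) \<open>0 < e\<close> by (intro bexI [of _ v]) auto
    qed (use elim assms(4) in auto)
  qed
qed

text \<open>Points of the fibers near \<open>v\<close> compete with the closest points, and the
  inequality survives in the limit. Whether \<open>l\<close> lies in \<open>H x\<close> is left open
  here; that takes a dimension argument.\<close>

lemma closest_point_limit:
  fixes H :: "'a::metric_space \<Rightarrow> 'b::euclidean_space set"
  assumes aff: "\<And>x. affine (H x)" and ne: "\<And>n. H (y n) \<noteq> {}"
    and F: "(\<lambda>n. F (y n)) \<longlonglongrightarrow> F x" and l: "(\<lambda>n. closest_point (H (y n)) (F (y n))) \<longlonglongrightarrow> l"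
    and v: "v \<in> liminf_fiber sequentially (\<lambda>n. H (y n))"
  shows "dist (F x) l \<le> dist (F x) v"
proof (rule field_le_epsilon)
  fix e :: real assume "0 < e"
  then have ev: "eventually (\<lambda>n. \<exists>w\<in>H (y n). dist v w < e) sequentially"
    using v by (simp add: liminf_fiber_def)
  have lim: "(\<lambda>n. dist (F (y n)) (closest_point (H (y n)) (F (y n)))) \<longlonglongrightarrow> dist (F x) l"
    "(\<lambda>n. dist (F (y n)) v + e) \<longlonglongrightarrow> dist (F x) v + e"
    by (intro tendsto_intros F l)+
  show "dist (F x) l \<le> dist (F x) v + e"
  proof (rule tendsto_le [OF _ lim(2,1)])
    show "eventually (\<lambda>n. dist (F (y n)) (closest_point (H (y n)) (F (y n))) \<le> dist (F (y n)) v + e)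
        sequentially"
      using ev
    proof eventually_elim
      case (elim n)
      then obtain w where w: "w \<in> H (y n)" "dist v w < e" by blast
      have "dist (F (y n)) (closest_point (H (y n)) (F (y n))) \<le> dist (F (y n)) w"
        by (intro closest_point_le affine_closed aff w(1))
      also have "\<dots> \<le> dist (F (y n)) v + dist v w" by (rule dist_triangle)
      finally show ?case using w(2) by simp
    qed
  qed simp
qed

lemma continuous_on_closest_point_stratum:
  fixes H :: "'a::metric_space \<Rightarrow> 'b::euclidean_space set"
  assumes aff: "\<And>x. affine (H x)" and ne: "\<And>x. x \<in> Q \<Longrightarrow> H x \<noteq> {}"
    and stable: "\<And>x. x \<in> Q \<Longrightarrow> H x \<subseteq> liminf_fiber (at x within Q) H"
    and F: "continuous_on Q F" "\<And>x. x \<in> Q \<Longrightarrow> aff_dim (H x) < d \<Longrightarrow> F x \<in> H x"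
  shows "continuous_on {x \<in> Q. aff_dim (H x) < d + 1} (\<lambda>x. closest_point (H x) (F x))"
  unfolding continuous_on_sequentially o_def
proof (intro ballI allI impI, elim conjE)
  fix x y assume "x \<in> {x \<in> Q. aff_dim (H x) < d + 1}"
    and yE: "\<forall>n. y n \<in> {x \<in> Q. aff_dim (H x) < d + 1}" and yx: "y \<longlonglongrightarrow> x"
  then have x: "x \<in> Q" "aff_dim (H x) < d + 1" and y: "y n \<in> Q" "aff_dim (H (y n)) < d + 1" for n
    by auto
  define \<psi> where "\<psi> x = closest_point (H x) (F x)" for x
  have \<psi>: "\<psi> x \<in> H x" if "x \<in> Q" for x
    unfolding \<psi>_def using aff ne [OF that] by (intro closest_point_in_set affine_closed)
  have Fy: "(\<lambda>n. F (y n)) \<longlonglongrightarrow> F x"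
    using F(1) x(1) y(1) yx unfolding continuous_on_sequentially o_def by blast
  have liminf: "v \<in> liminf_fiber sequentially (\<lambda>n. H (y (r n)))" if "v \<in> H x" "strict_mono r" for v r
    using liminf_fiber_sequentially [of v H x Q "y \<circ> r"] stable [OF x(1)] that y(1)
      LIMSEQ_subseq_LIMSEQ [OF yx that(2)] by auto
  have "(\<lambda>n. \<psi> (y n)) \<longlonglongrightarrow> \<psi> x"
  proof (rule tendsto_unique_cluster)
    \<comment> \<open>A point of the nearby fiber close to \<open>\<psi> x\<close> competes with the
      closest point and so keeps \<open>\<psi> (y n)\<close> bounded. It then suffices to identify
      the cluster points.\<close>
    have "\<psi> x \<in> liminf_fiber sequentially (\<lambda>n. H (y n))"
      using liminf [OF \<psi> [OF x(1)] strict_mono_id] by simp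
    then have "eventually (\<lambda>n. \<exists>w\<in>H (y n). dist (\<psi> x) w < 1) sequentially"
      by (simp add: liminf_fiber_def)
    moreover have "eventually (\<lambda>n. dist (F (y n)) (F x) < 1) sequentially"
      using Fy by (rule tendstoD) simp
    ultimately have "eventually (\<lambda>n. norm (\<psi> (y n)) \<le> 2 * norm (F x) + norm (\<psi> x) + 3) sequentially"
    proof eventually_elim
      case (elim n)
      then obtain w where w: "w \<in> H (y n)" "dist (\<psi> x) w < 1" by blast
      have "dist (F (y n)) (\<psi> (y n)) \<le> dist (F (y n)) w"
        unfolding \<psi>_def by (intro closest_point_le affine_closed aff w(1))
      then have "norm (\<psi> (y n)) \<le> norm (F (y n)) + norm (F (y n) - w)"
        using norm_triangle_sub [of "\<psi> (y n)" "F (y n)"] by (simp add: dist_norm norm_minus_commute)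
      moreover have "norm (F (y n)) \<le> norm (F x) + 1"
        using norm_triangle_sub [of "F (y n)" "F x"] elim by (simp add: dist_norm)
      moreover have "norm (F (y n) - w) \<le> norm (F (y n)) + norm w" by (rule norm_triangle_ineq4)
      moreover have "norm w \<le> norm (\<psi> x) + 1"
        using norm_triangle_sub [of w "\<psi> x"] w(2) by (simp add: dist_norm norm_minus_commute)
      ultimately show ?case by linarith
    qed
    then show "Bseq (\<lambda>n. \<psi> (y n))" by (rule BfunI)
  next
    fix r :: "nat \<Rightarrow> nat" and l
    assume r: "strict_mono r" and "((\<lambda>n. \<psi> (y n)) \<circ> r) \<longlonglongrightarrow> l"
    then have l: "(\<lambda>n. \<psi> (y (r n))) \<longlonglongrightarrow> l" by (simp add: o_def)
    have "(\<lambda>n. F (y (r n))) \<longlonglongrightarrow> F x"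
      using LIMSEQ_subseq_LIMSEQ [OF Fy r] by (simp add: o_def)
    then have min: "dist (F x) l \<le> dist (F x) v" if "v \<in> H x" for v
      using closest_point_limit [of H "\<lambda>n. y (r n)" F x l v] aff ne y(1) l liminf [OF that r]
      unfolding \<psi>_def by blast
    show "l = \<psi> x"
    proof (cases "aff_dim (H x) < d")
      case True
      then have "F x \<in> H x" using F(2) x by blast
      then show ?thesis using min [of "F x"] by (simp add: \<psi>_def closest_point_self)
    next
      case False
      \<comment> \<open>\<open>L\<close> contains both \<open>H x\<close> and the cluster point
        \<open>l\<close>. Its dimension is at most that of the fibers along the sequence, hence at
        most \<open>d\<close>, so \<open>L\<close> coincides with \<open>H x\<close>.\<close>
      define L where "L = liminf_fiber sequentially (\<lambda>n. H (y (r n)))"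
      have affL: "affine L" unfolding L_def by (intro affine_liminf_fiber aff)
      have sub: "H x \<subseteq> L" using liminf r by (auto simp: L_def)
      have "l \<in> L"
        unfolding L_def liminf_fiber_def
      proof (intro CollectI allI impI)
        fix e :: real assume "0 < e"
        then have "eventually (\<lambda>n. dist (\<psi> (y (r n))) l < e) sequentially" using l by (rule tendstoD [rotated])
        then show "eventually (\<lambda>n. \<exists>w\<in>H (y (r n)). dist l w < e) sequentially"
          using \<psi> y(1) by (auto elim!: eventually_mono simp: dist_commute)
      qed
      have "eventually (\<lambda>n. aff_dim L \<le> aff_dim (H (y (r n)))) sequentially"
        unfolding L_def by (intro aff_dim_liminf_fiber aff)
      then obtain n where "aff_dim L \<le> aff_dim (H (y (r n)))"
        unfolding eventually_sequentially by blast
      then have "aff_dim L \<le> aff_dim (H x)" using y(2) [of "r n"] False by linarith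
      then have "aff_dim (H x) = aff_dim L" using aff_dim_subset [OF sub] by simp
      then have "H x = L" using affine_dim_equal [OF aff affL ne [OF x(1)] sub] by blast
      then have "l \<in> H x" using \<open>l \<in> L\<close> by simp
      then show ?thesis
        unfolding \<psi>_def using min aff
        by (intro closest_point_unique affine_imp_convex affine_closed ballI)
    qed
  qed
  then show "(\<lambda>n. closest_point (H (y n)) (F (y n))) \<longlonglongrightarrow> closest_point (H x) (F x)"
    by (simp add: \<psi>_def)
qed

text \<open>The nearest point of a nonempty closed convex set is unique, so minimality of the
  distance describes the graph in first-order terms. The value 0 off \<open>Q\<close> makes the
  function total.\<close>

lemma semialgebraic_fun_closest_point:
  fixes H :: "'a::euclidean_space \<Rightarrow> 'b::euclidean_space set"
  assumes Q: "semialgebraic Q" and H: "semialgebraic_bundle Q H" and aff: "\<And>x. affine (H x)"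
    and ne: "\<And>x. x \<in> Q \<Longrightarrow> H x \<noteq> {}" and F: "semialgebraic_fun F"
  shows "semialgebraic_fun (\<lambda>x. if x \<in> Q then closest_point (H x) (F x) else 0)"
proof -
  define G where "G = {z. fst z \<in> Q \<and> snd z \<in> H (fst z)}"
  have G: "semialgebraic G" using H by (simp add: G_def semialgebraic_bundle_def)
  note F' [semialgebraic_intros] = semialgebraic_fun_compose [OF _ F]
  have "semialgebraic {z. z \<in> G \<and> (\<forall>u. (fst z, u) \<in> G \<longrightarrow> dist (F (fst z)) (snd z) \<le> dist (F (fst z)) u)
      \<or> \<not> fst z \<in> Q \<and> snd z = 0}"
    by (intro semialgebraic_intros Q G)
  moreover have "(z \<in> G \<and> (\<forall>u. (fst z, u) \<in> G \<longrightarrow> dist (F (fst z)) (snd z) \<le> dist (F (fst z)) u)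
      \<or> \<not> fst z \<in> Q \<and> snd z = 0) \<longleftrightarrow>
      snd z = (if fst z \<in> Q then closest_point (H (fst z)) (F (fst z)) else 0)" for z
  proof (cases "fst z \<in> Q")
    case True
    have "snd z \<in> H (fst z) \<and> (\<forall>u\<in>H (fst z). dist (F (fst z)) (snd z) \<le> dist (F (fst z)) u) \<longleftrightarrow>
        snd z = closest_point (H (fst z)) (F (fst z))"
      using closest_point_unique [OF affine_imp_convex [OF aff] affine_closed [OF aff]]
        closest_point_exists [OF affine_closed [OF aff] ne [OF True]] by metis
    then show ?thesis using True by (auto simp: G_def)
  next
    case False
    then show ?thesis by (simp add: G_def)
  qed
  ultimately show ?thesis by (simp add: semialgebraic_fun_iff)
qed

lemma semialgebraic_selection:
  fixes H :: "'a::euclidean_space \<Rightarrow> (real ^ 's) set"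
  assumes Q: "compact Q" "semialgebraic Q" and H: "semialgebraic_bundle Q H" and aff: "\<And>x. affine (H x)"
    and ne: "\<And>x. x \<in> Q \<Longrightarrow> H x \<noteq> {}"
    and stable: "\<And>x. x \<in> Q \<Longrightarrow> H x \<subseteq> liminf_fiber (at x within Q) H"
  obtains \<phi> where "semialgebraic_fun \<phi>" "continuous_on Q \<phi>" "\<And>x. x \<in> Q \<Longrightarrow> \<phi> x \<in> H x"
proof -
  \<comment> \<open>Only the empty set has negative dimension, so \<open>E 0\<close> is empty, while
    \<open>E (Suc CARD('s))\<close> is all of \<open>Q\<close>. Passing from \<open>m\<close> to
    \<open>Suc m\<close> admits the fibers of dimension exactly \<open>m\<close>.\<close>
  define E where "E m = {x \<in> Q. aff_dim (H x) < int m}" for m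
  have "\<exists>\<phi>. semialgebraic_fun \<phi> \<and> continuous_on (E m) \<phi> \<and> (\<forall>x\<in>E m. \<phi> x \<in> H x)"
    if "m \<le> Suc CARD('s)" for m
    using that
  proof (induction m)
    case 0
    have "E 0 = {}" using ne by (auto simp: E_def)
    then show ?case using semialgebraic_fun_const [of "0 :: real ^ 's"] by (intro exI [of _ "\<lambda>_. 0"]) simp
  next
    case (Suc m)
    then obtain \<phi> where \<phi>: "semialgebraic_fun \<phi>" "continuous_on (E m) \<phi>" "\<forall>x\<in>E m. \<phi> x \<in> H x" by auto
    have "closed (E m)"
      unfolding E_def by (intro closed_low_dim compact_imp_closed Q aff stable)
    moreover have EQ: "E m \<subseteq> Q" for m by (auto simp: E_def)
    ultimately have "compact (E m)" using compact_Int_closed [OF Q(1)] by (metis inf.absorb_iff2)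
    moreover have "semialgebraic (E m)"
      unfolding E_def using Suc.prems by (intro semialgebraic_low_dim Q H aff) simp
    ultimately obtain F where F: "semialgebraic_fun F" "continuous_on UNIV F" "\<forall>x\<in>E m. F x = \<phi> x"
      using semialgebraic_tietze [OF _ _ \<phi>(1,2)] by metis
    define \<psi> where "\<psi> x = (if x \<in> Q then closest_point (H x) (F x) else 0)" for x
    have "semialgebraic_fun \<psi>"
      unfolding \<psi>_def by (intro semialgebraic_fun_closest_point Q H aff ne F(1))
    moreover have "continuous_on (E (Suc m)) \<psi>"
    proof -
      have "continuous_on {x \<in> Q. aff_dim (H x) < int m + 1} (\<lambda>x. closest_point (H x) (F x))"
      proof (rule continuous_on_closest_point_stratum [OF aff ne stable])
        show "continuous_on Q F" using F(2) by (rule continuous_on_subset) simp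
        show "F x \<in> H x" if "x \<in> Q" "aff_dim (H x) < int m" for x
          using F(3) \<phi>(3) that by (simp add: E_def)
      qed
      then show ?thesis
        by (rule continuous_on_cong [THEN iffD1, rotated 2]) (auto simp: E_def \<psi>_def)
    qed
    moreover have "\<psi> x \<in> H x" if "x \<in> E (Suc m)" for x
      using that EQ ne aff unfolding \<psi>_def by (auto intro!: closest_point_in_set affine_closed)
    ultimately show ?case by blast
  qed
  moreover have "aff_dim (H x) < int (Suc CARD('s))" for x
    using aff_dim_le_DIM [of "H x"] by simp
  then have "E (Suc CARD('s)) = Q" by (auto simp: E_def)
  ultimately show ?thesis using that by (metis order_refl)
qed

text \<open>By induction \<open>\<phi> y\<close> lies in the refined fiber over each nearby
  \<open>y\<close>, and continuity makes it a point close to \<open>\<phi> x\<close>.\<close>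

lemma continuous_selection_in_glaeser_iter:
  fixes \<phi> :: "'a::metric_space \<Rightarrow> 'b::metric_space"
  assumes "continuous_on Q \<phi>" and "\<And>x. x \<in> Q \<Longrightarrow> \<phi> x \<in> H x" and "x \<in> Q"
  shows "\<phi> x \<in> glaeser_iter Q H k x"
  using assms(3)
proof (induction k arbitrary: x)
  case 0
  then show ?case using assms(2) by simp
next
  case (Suc k)
  have "eventually (\<lambda>y. \<exists>w\<in>glaeser_iter Q H k y. dist (\<phi> x) w < e) (at x within Q)" if "0 < e" for e
  proof -
    have "(\<phi> \<longlongrightarrow> \<phi> x) (at x within Q)" using assms(1) Suc.prems by (simp add: continuous_on)
    then have "eventually (\<lambda>y. dist (\<phi> y) (\<phi> x) < e) (at x within Q)" using that by (rule tendstoD)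
    moreover have "eventually (\<lambda>y. y \<in> Q) (at x within Q)" by (simp add: eventually_at_filter)
    ultimately show ?thesis
    proof eventually_elim
      case (elim y)
      then show ?case using Suc.IH [of y] by (intro bexI [of _ "\<phi> y"]) (simp_all add: dist_commute)
    qed
  qed
  then show ?case using Suc by (simp add: glaeser_refine_eq liminf_fiber_def)
qed

theorem theorem3p1:
  fixes Q :: "(real ^ 'n) set"
    and A :: "real ^ 'n \<Rightarrow> real ^ 's ^ 'r"
    and \<gamma> :: "real ^ 'n \<Rightarrow> real ^ 'r"
  assumes "compact Q"
    and "semialgebraic Q"
    and "\<And>i j. semialgebraic_on UNIV (\<lambda>x. A x $ i $ j)"
    and "\<And>i. semialgebraic_on UNIV (\<lambda>x. \<gamma> x $ i)"
  shows "(\<exists>\<phi> :: real ^ 'n \<Rightarrow> real ^ 's.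
            continuous_on Q \<phi> \<and> semialgebraic_on Q \<phi> \<and> (\<forall>x\<in>Q. A x *v \<phi> x = \<gamma> x))
     \<longleftrightarrow> (\<forall>x\<in>Q. glaeser_stable Q (solution_bundle A \<gamma>) x \<noteq> {})"
proof -
  let ?H = "solution_bundle A \<gamma>"
  obtain k where k: "glaeser_stable Q ?H = glaeser_iter Q ?H k"
    "\<And>x. x \<in> Q \<Longrightarrow> glaeser_refine Q (glaeser_stable Q ?H) x = glaeser_stable Q ?H x"
    by (rule glaeser_stable_properties [of ?H Q]) (auto simp: affine_solution_bundle)
  show ?thesis
  proof
    assume "\<exists>\<phi> :: real ^ 'n \<Rightarrow> real ^ 's.
            continuous_on Q \<phi> \<and> semialgebraic_on Q \<phi> \<and> (\<forall>x\<in>Q. A x *v \<phi> x = \<gamma> x)"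
    then obtain \<phi> :: "real ^ 'n \<Rightarrow> real ^ 's"
      where "continuous_on Q \<phi>" "\<And>x. x \<in> Q \<Longrightarrow> \<phi> x \<in> ?H x"
      by (auto simp: solution_bundle_def)
    then show "\<forall>x\<in>Q. glaeser_stable Q ?H x \<noteq> {}"
      using continuous_selection_in_glaeser_iter [of Q \<phi> ?H] k(1) by fastforce
  next
    assume ne: "\<forall>x\<in>Q. glaeser_stable Q ?H x \<noteq> {}"
    obtain \<phi> where \<phi>: "semialgebraic_fun \<phi>" "continuous_on Q \<phi>"
      "\<forall>x\<in>Q. \<phi> x \<in> glaeser_stable Q ?H x"
    proof (rule semialgebraic_selection [of Q "glaeser_stable Q ?H"])
      show "semialgebraic_bundle Q (glaeser_stable Q ?H)"
        unfolding k(1) by (intro semialgebraic_bundle_iter semialgebraic_bundle_solution assms(2-4))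
      show "affine (glaeser_stable Q ?H x)" for x
        unfolding k(1) by (intro affine_glaeser_iter affine_solution_bundle)
      show "glaeser_stable Q ?H x \<subseteq> liminf_fiber (at x within Q) (glaeser_stable Q ?H)" if "x \<in> Q" for x
        using k(2) [OF that] by (auto simp: glaeser_refine_eq)
    qed (use assms ne in auto)
    have sub: "glaeser_iter Q ?H k x \<subseteq> ?H x" for k x
      by (induction k) (use glaeser_refine_subset in fastforce)+
    have "semialgebraic_on Q \<phi>"
      unfolding semialgebraic_on_iff using \<phi>(1)
      by (intro semialgebraic_conj semialgebraic_mem assms(2) semialgebraic_fun_fst')
        (simp add: semialgebraic_fun_iff)
    moreover have "A x *v \<phi> x = \<gamma> x" if "x \<in> Q" for x
      using \<phi>(3) sub [of k x] that unfolding k(1) solution_bundle_def by blast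
    ultimately show "\<exists>\<phi> :: real ^ 'n \<Rightarrow> real ^ 's.
            continuous_on Q \<phi> \<and> semialgebraic_on Q \<phi> \<and> (\<forall>x\<in>Q. A x *v \<phi> x = \<gamma> x)"
      using \<phi>(2) by blast
  qed
qed

end
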